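(* Let $X$ be a Tychonoff space and let $1\le p<\infty$. If there is a continuous linear surjection $Q:C_{\mathrm p}(X)\to(\ell_p)_{\mathrm p}$, then $C_{\mathrm p}(X)$ has the Josefson–Nissenzweig property. Consequently, $C_{\mathrm p}(X)$ has a quotient isomorphic to $(c_0)_{\mathrm p}$.
   Context: $C_{\mathrm p}(X)$ is the space of real-valued continuous functions on $X$ with the topology of pointwise convergence. For a Banach sequence space $Y\subseteq\mathbb R^\omega$ (such as $\ell_p$, $c_0$), $Y_{\mathrm p}$ denotes $Y$ with the topology inherited from the product $\mathbb R^\omega$. A quotient map between locally convex spaces is a continuous open linear surjection onto the target; "$E$ has a quotient isomorphic to $F$" means that there is such a quotient of $E$ linearly homeomorphic to $F$. A locally convex space $E$ with topological dual $E'$ has the Josefson–Nissenzweig property if the identity map $(E',\sigma(E',E))\to(E',\beta^*(E',E))$ is not sequentially continuous, where $\beta^*(E',E)$ is the topology of uniform convergence on barrel-bounded subsets of $E$ (a set is barrel-bounded if it is absorbed by every barrel, i.e. by every closed absolutely convex absorbing subset of $E$). For $E=C_{\mathrm p}(X)$ this is equivalent to the existence of a sequence of finitely supported signed measures on $X$ (elements of $C_{\mathrm p}(X)'=\operatorname{span}\{\delta_x:x\in X\}$) of total variation norm one which converges to $0$ at every $f\in C(X)$. *)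

theory Defs
  imports "HOL-Analysis.Analysis" "HOL-Library.Function_Algebras"
begin

text \<open>
  The pointwise vector space structure on real-valued functions, extending the pointwise addition
  of \<open>Function_Algebras\<close>.
\<close>

instantiation "fun" :: (type, real_vector) real_vector
begin

definition scaleR_fun_def: "c *\<^sub>R f = (\<lambda>x. c *\<^sub>R f x)"

instance
  by standard (simp_all add: scaleR_fun_def fun_eq_iff scaleR_add_right scaleR_add_left)

end

lemma scaleR_fun_apply [simp]: "(c *\<^sub>R f) x = c *\<^sub>R f x"
  by (simp add: scaleR_fun_def)


section \<open>Locally convex spaces\<close>

text \<open>
  A topological vector space \<open>E\<close> is represented by an abstract topology whose underlying set
  \<open>topspace E\<close> is a linear subspace of an ambient real vector space.  The ambient type carries
  no topology of its own as far as \<open>E\<close> is concerned.  Local convexity includes the Hausdorff axiom.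
\<close>

definition locally_convex_space :: "'a::real_vector topology \<Rightarrow> bool" where
  "locally_convex_space E \<longleftrightarrow>
     subspace (topspace E) \<and>
     Hausdorff_space E \<and>
     continuous_map (prod_topology E E) E (\<lambda>(x, y). x + y) \<and>
     continuous_map (prod_topology euclideanreal E) E (\<lambda>(c, x). c *\<^sub>R x) \<and>
     (\<forall>U. openin E U \<and> 0 \<in> U \<longrightarrow> (\<exists>V. openin E V \<and> 0 \<in> V \<and> convex V \<and> V \<subseteq> U))"

definition linear_map_on :: "'a::real_vector set \<Rightarrow> ('a \<Rightarrow> 'b::real_vector) \<Rightarrow> bool" where
  "linear_map_on S f \<longleftrightarrow>
     (\<forall>x\<in>S. \<forall>y\<in>S. f (x + y) = f x + f y) \<and> (\<forall>c. \<forall>x\<in>S. f (c *\<^sub>R x) = c *\<^sub>R f x)"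

definition continuous_linear_surjection ::
  "'a::real_vector topology \<Rightarrow> 'b::real_vector topology \<Rightarrow> ('a \<Rightarrow> 'b) \<Rightarrow> bool" where
  "continuous_linear_surjection E F q \<longleftrightarrow>
     linear_map_on (topspace E) q \<and> continuous_map E F q \<and> q ` topspace E = topspace F"

definition linear_quotient_map ::
  "'a::real_vector topology \<Rightarrow> 'b::real_vector topology \<Rightarrow> ('a \<Rightarrow> 'b) \<Rightarrow> bool" where
  "linear_quotient_map E G q \<longleftrightarrow> continuous_linear_surjection E G q \<and> open_map E G q"

definition linear_homeomorphism ::
  "'a::real_vector topology \<Rightarrow> 'b::real_vector topology \<Rightarrow> ('a \<Rightarrow> 'b) \<Rightarrow> bool" where
  "linear_homeomorphism G F h \<longleftrightarrow> linear_map_on (topspace G) h \<and> homeomorphic_map G F h"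

text \<open>
  The quotient \<open>G\<close> ranges over locally convex spaces in the ambient type of \<open>F\<close>.  This loses
  nothing: any space linearly homeomorphic to \<open>F\<close> can be replaced by such a copy.
\<close>

definition has_quotient_isomorphic ::
  "'a::real_vector topology \<Rightarrow> 'b::real_vector topology \<Rightarrow> bool" where
  "has_quotient_isomorphic E F \<longleftrightarrow>
     (\<exists>(G :: 'b topology) q h.
        locally_convex_space G \<and> linear_quotient_map E G q \<and> linear_homeomorphism G F h)"


section \<open>Barrels and barrel-bounded sets\<close>

definition balanced :: "'a::real_vector set \<Rightarrow> bool" where
  "balanced D \<longleftrightarrow> (\<forall>c x. \<bar>c\<bar> \<le> 1 \<and> x \<in> D \<longrightarrow> c *\<^sub>R x \<in> D)"

definition absorbs :: "'a::real_vector set \<Rightarrow> 'a set \<Rightarrow> bool" where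
  "absorbs D B \<longleftrightarrow> (\<exists>r>0. \<forall>c. r \<le> \<bar>c\<bar> \<longrightarrow> B \<subseteq> (\<lambda>x. c *\<^sub>R x) ` D)"

definition barrel :: "'a::real_vector topology \<Rightarrow> 'a set \<Rightarrow> bool" where
  "barrel E D \<longleftrightarrow>
     closedin E D \<and> convex D \<and> balanced D \<and> (\<forall>x\<in>topspace E. absorbs D {x})"

definition barrel_bounded :: "'a::real_vector topology \<Rightarrow> 'a set \<Rightarrow> bool" where
  "barrel_bounded E B \<longleftrightarrow> B \<subseteq> topspace E \<and> (\<forall>D. barrel E D \<longrightarrow> absorbs D B)"


section \<open>The dual and its topologies\<close>

definition pointwise_topology :: "('i \<Rightarrow> real) set \<Rightarrow> ('i \<Rightarrow> real) topology" where
  "pointwise_topology Y = subtopology (product_topology (\<lambda>_. euclideanreal) UNIV) Y"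

text \<open>
  Functionals on \<open>E\<close> are normalised to be zero off \<open>topspace E\<close>, so that they are determined by their
  values on \<open>E\<close> and the coordinates outside \<open>E\<close> contribute nothing to the pointwise topology.
\<close>

definition top_dual :: "'a::real_vector topology \<Rightarrow> ('a \<Rightarrow> real) set" where
  "top_dual E = {\<phi>. linear_map_on (topspace E) \<phi> \<and> continuous_map E euclideanreal \<phi> \<and>
                    (\<forall>x. x \<notin> topspace E \<longrightarrow> \<phi> x = 0)}"

definition weak_star_topology :: "'a::real_vector topology \<Rightarrow> ('a \<Rightarrow> real) topology" where
  "weak_star_topology E = pointwise_topology (top_dual E)"

definition beta_star_open :: "'a::real_vector topology \<Rightarrow> ('a \<Rightarrow> real) set \<Rightarrow> bool" where
  "beta_star_open E U \<longleftrightarrow> U \<subseteq> top_dual E \<and>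
     (\<forall>\<phi>\<in>U. \<exists>B \<epsilon>. barrel_bounded E B \<and> \<epsilon> > 0 \<and>
        {\<psi> \<in> top_dual E. \<forall>x\<in>B. \<bar>\<psi> x - \<phi> x\<bar> < \<epsilon>} \<subseteq> U)"

definition beta_star_topology :: "'a::real_vector topology \<Rightarrow> ('a \<Rightarrow> real) topology" where
  "beta_star_topology E = topology (beta_star_open E)"

definition seq_continuous_map :: "'a topology \<Rightarrow> 'b topology \<Rightarrow> ('a \<Rightarrow> 'b) \<Rightarrow> bool" where
  "seq_continuous_map X Y f \<longleftrightarrow>
     f ` topspace X \<subseteq> topspace Y \<and>
     (\<forall>s l. range s \<subseteq> topspace X \<and> limitin X s l sequentially
        \<longrightarrow> limitin Y (\<lambda>n. f (s n)) (f l) sequentially)"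

definition josefson_nissenzweig :: "'a::real_vector topology \<Rightarrow> bool" where
  "josefson_nissenzweig E \<longleftrightarrow>
     \<not> seq_continuous_map (weak_star_topology E) (beta_star_topology E) id"


section \<open>Function and sequence spaces\<close>

definition tychonoff_space :: "'a topology \<Rightarrow> bool" where
  "tychonoff_space X \<longleftrightarrow> completely_regular_space X \<and> Hausdorff_space X"

text \<open>
  Continuous functions on \<open>X\<close> are extended by zero off \<open>topspace X\<close>.  The library's usual value
  \<open>undefined\<close> would not be compatible with pointwise addition.
\<close>

definition Cp :: "'a topology \<Rightarrow> ('a \<Rightarrow> real) topology" where
  "Cp X = pointwise_topology
     {f. continuous_map X euclideanreal f \<and> (\<forall>x. x \<notin> topspace X \<longrightarrow> f x = 0)}"

definition lp_p :: "real \<Rightarrow> (nat \<Rightarrow> real) topology" where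
  "lp_p p = pointwise_topology {x. summable (\<lambda>n. \<bar>x n\<bar> powr p)}"

definition c0_p :: "(nat \<Rightarrow> real) topology" where
  "c0_p = pointwise_topology {x. x \<longlonglongrightarrow> 0}"


section \<open>Well-definedness of the above\<close>

lemma absorbs_Un:
  assumes "absorbs D A" "absorbs D B" shows "absorbs D (A \<union> B)"
proof -
  obtain r s where "r > 0" "\<forall>c. r \<le> \<bar>c\<bar> \<longrightarrow> A \<subseteq> (\<lambda>x. c *\<^sub>R x) ` D"
    and "s > 0" "\<forall>c. s \<le> \<bar>c\<bar> \<longrightarrow> B \<subseteq> (\<lambda>x. c *\<^sub>R x) ` D"
    using assms unfolding absorbs_def by auto
  then show ?thesis
    unfolding absorbs_def by (intro exI[of _ "max r s"]) auto
qed

lemma barrel_bounded_Un: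
  "barrel_bounded E A \<Longrightarrow> barrel_bounded E B \<Longrightarrow> barrel_bounded E (A \<union> B)"
  unfolding barrel_bounded_def by (auto intro: absorbs_Un)

lemma barrel_bounded_empty: "barrel_bounded E {}"
  unfolding barrel_bounded_def absorbs_def by (auto intro: exI[of _ 1])

lemma istopology_beta_star: "istopology (beta_star_open E)"
  unfolding istopology_def
proof (intro conjI allI impI)
  fix S T assume S: "beta_star_open E S" and T: "beta_star_open E T"
  show "beta_star_open E (S \<inter> T)"
    unfolding beta_star_open_def
  proof (intro conjI ballI)
    show "S \<inter> T \<subseteq> top_dual E"
      using S unfolding beta_star_open_def by auto
    fix \<phi> assume "\<phi> \<in> S \<inter> T"
    then obtain A d B e where
      A: "barrel_bounded E A" "d > 0" "{\<psi> \<in> top_dual E. \<forall>x\<in>A. \<bar>\<psi> x - \<phi> x\<bar> < d} \<subseteq> S" and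
      B: "barrel_bounded E B" "e > 0" "{\<psi> \<in> top_dual E. \<forall>x\<in>B. \<bar>\<psi> x - \<phi> x\<bar> < e} \<subseteq> T"
      using S T unfolding beta_star_open_def by (meson IntD1 IntD2)
    have "{\<psi> \<in> top_dual E. \<forall>x\<in>A \<union> B. \<bar>\<psi> x - \<phi> x\<bar> < min d e} \<subseteq> S \<inter> T"
      using A(3) B(3) by auto
    then show "\<exists>B \<epsilon>. barrel_bounded E B \<and> \<epsilon> > 0 \<and>
        {\<psi> \<in> top_dual E. \<forall>x\<in>B. \<bar>\<psi> x - \<phi> x\<bar> < \<epsilon>} \<subseteq> S \<inter> T"
      using A(1,2) B(1,2) barrel_bounded_Un by (intro exI[of _ "A \<union> B"] exI[of _ "min d e"]) auto
  qed
next
  fix K assume K: "\<forall>S\<in>K. beta_star_open E S"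
  show "beta_star_open E (\<Union>K)"
    unfolding beta_star_open_def
  proof (intro conjI ballI)
    show "\<Union>K \<subseteq> top_dual E"
      using K unfolding beta_star_open_def by auto
    fix \<phi> assume "\<phi> \<in> \<Union>K"
    then obtain S where S: "S \<in> K" "\<phi> \<in> S" by auto
    then obtain B e where "barrel_bounded E B" "e > 0"
      "{\<psi> \<in> top_dual E. \<forall>x\<in>B. \<bar>\<psi> x - \<phi> x\<bar> < e} \<subseteq> S"
      using K unfolding beta_star_open_def by meson
    then show "\<exists>B \<epsilon>. barrel_bounded E B \<and> \<epsilon> > 0 \<and>
        {\<psi> \<in> top_dual E. \<forall>x\<in>B. \<bar>\<psi> x - \<phi> x\<bar> < \<epsilon>} \<subseteq> \<Union>K"
      using S by (intro exI[of _ B] exI[of _ e]) auto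
  qed
qed

lemma openin_beta_star: "openin (beta_star_topology E) U \<longleftrightarrow> beta_star_open E U"
  unfolding beta_star_topology_def using istopology_beta_star topology_inverse' by metis

lemma topspace_beta_star [simp]: "topspace (beta_star_topology E) = top_dual E"
proof -
  have "beta_star_open E (top_dual E)"
    unfolding beta_star_open_def
    by (auto intro!: exI[of _ "{}"] exI[of _ "1::real"] barrel_bounded_empty)
  then show ?thesis
    unfolding topspace_def openin_beta_star by (auto simp: beta_star_open_def)
qed

lemma topspace_pointwise [simp]: "topspace (pointwise_topology Y) = Y"
  unfolding pointwise_topology_def by simp

lemma limitin_pointwise:
  "limitin (pointwise_topology Y) s l sequentially \<longleftrightarrow>
     l \<in> Y \<and> (\<forall>\<^sub>F n in sequentially. s n \<in> Y) \<and> (\<forall>i. (\<lambda>n. s n i) \<longlonglongrightarrow> l i)"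
  unfolding pointwise_topology_def limitin_subtopology limitin_componentwise by auto

lemma continuous_map_into_pointwise:
  "continuous_map Z (pointwise_topology Y) f \<longleftrightarrow>
     (\<forall>z\<in>topspace Z. f z \<in> Y) \<and> (\<forall>i. continuous_map Z euclideanreal (\<lambda>z. f z i))"
  unfolding pointwise_topology_def continuous_map_in_subtopology continuous_map_componentwise_UNIV
  by auto

lemma continuous_map_coordinate:
  "continuous_map (pointwise_topology Y) euclideanreal (\<lambda>f. f i)"
  using continuous_map_into_pointwise[of "pointwise_topology Y" Y id]
  by (simp add: id_def)

lemma locally_convex_pointwise:
  assumes Y: "subspace Y"
  shows "locally_convex_space (pointwise_topology Y)"
  unfolding locally_convex_space_def
proof (intro conjI allI impI)
  let ?T = "pointwise_topology Y"
  show "subspace (topspace ?T)" using Y by simp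
  show "Hausdorff_space ?T"
    unfolding pointwise_topology_def
    by (intro Hausdorff_space_subtopology) (simp add: Hausdorff_space_product_topology)
  show "continuous_map (prod_topology ?T ?T) ?T (\<lambda>(x, y). x + y)"
    unfolding continuous_map_into_pointwise
  proof (intro conjI allI ballI)
    fix i
    have "continuous_map (prod_topology ?T ?T) euclideanreal (\<lambda>z. fst z i + snd z i)"
      by (intro continuous_map_add
          continuous_map_compose[OF continuous_map_fst continuous_map_coordinate, unfolded comp_def]
          continuous_map_compose[OF continuous_map_snd continuous_map_coordinate, unfolded comp_def])
    then show "continuous_map (prod_topology ?T ?T) euclideanreal (\<lambda>z. (case z of (x, y) \<Rightarrow> x + y) i)"
      by (simp add: case_prod_unfold)
  qed (use Y in \<open>auto intro: subspace_add\<close>)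
  show "continuous_map (prod_topology euclideanreal ?T) ?T (\<lambda>(c, x). c *\<^sub>R x)"
    unfolding continuous_map_into_pointwise
  proof (intro conjI allI ballI)
    fix i
    have "continuous_map (prod_topology euclideanreal ?T) euclideanreal (\<lambda>z. fst z * snd z i)"
      by (intro continuous_map_real_mult continuous_map_fst
          continuous_map_compose[OF continuous_map_snd continuous_map_coordinate, unfolded comp_def])
    then show "continuous_map (prod_topology euclideanreal ?T) euclideanreal
        (\<lambda>z. (case z of (c, x) \<Rightarrow> c *\<^sub>R x) i)"
      by (simp add: case_prod_unfold)
  qed (use Y in \<open>auto intro: subspace_scale\<close>)
  fix U assume "openin ?T U \<and> 0 \<in> U"
  then obtain W where W: "openin (product_topology (\<lambda>_. euclideanreal) UNIV) W"
    and U: "U = W \<inter> Y" and "0 \<in> W" "0 \<in> Y"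
    unfolding pointwise_topology_def openin_subtopology by auto
  then obtain A where A: "finite {i. A i \<noteq> UNIV}" "\<And>i. open (A i)" "0 \<in> PiE UNIV A" "PiE UNIV A \<subseteq> W"
    unfolding openin_product_topology_alt by (auto simp: Pi_iff)
  have "\<exists>e>0. ball 0 e \<subseteq> A i" for i
    using A(2)[of i] A(3) by (auto simp: open_contains_ball PiE_iff)
  then obtain e where e: "\<And>i. e i > 0" "\<And>i. ball 0 (e i) \<subseteq> A i" by metis
  define B where "B i = (if A i = UNIV then UNIV else ball (0::real) (e i))" for i
  have "openin (product_topology (\<lambda>_. euclideanreal) UNIV) (PiE UNIV B)"
    unfolding openin_PiE_gen
    by (intro disjI2 conjI) (auto simp: B_def intro: finite_subset[OF _ A(1)])
  then have 1: "openin ?T (PiE UNIV B \<inter> Y)"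
    unfolding pointwise_topology_def openin_subtopology by auto
  have 2: "0 \<in> PiE UNIV B \<inter> Y"
    using e(1) \<open>0 \<in> Y\<close> by (auto simp: B_def)
  have cB: "convex (B i)" for i by (simp add: B_def)
  have "convex (PiE UNIV B)"
    unfolding convex_def using cB by (auto simp: PiE_iff convex_def)
  then have 3: "convex (PiE UNIV B \<inter> Y)"
    using convex_Int[OF _ subspace_imp_convex[OF Y]] by blast
  have "PiE UNIV B \<subseteq> PiE UNIV A"
    using e(2) by (intro PiE_mono) (auto simp: B_def)
  then have "PiE UNIV B \<inter> Y \<subseteq> U" using A(4) U by auto
  with 1 2 3 show "\<exists>V. openin ?T V \<and> 0 \<in> V \<and> convex V \<and> V \<subseteq> U" by blast
qed

lemma locally_convex_Cp: "locally_convex_space (Cp X)"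
  unfolding Cp_def
  by (intro locally_convex_pointwise)
     (auto simp: subspace_def plus_fun_def zero_fun_def scaleR_fun_def
       intro: continuous_map_add continuous_map_real_mult_left)

lemma locally_convex_c0_p: "locally_convex_space c0_p"
  unfolding c0_p_def
proof (intro locally_convex_pointwise)
  have "(\<lambda>n. c * x n) \<longlonglongrightarrow> 0" if "x \<longlonglongrightarrow> 0" for c :: real and x
    using tendsto_mult_right_zero[OF that] by simp
  moreover have "(\<lambda>n. x n + y n) \<longlonglongrightarrow> 0" if "x \<longlonglongrightarrow> 0" "y \<longlonglongrightarrow> 0" for x y :: "nat \<Rightarrow> real"
    using tendsto_add[OF that] by simp
  ultimately show "subspace {x :: nat \<Rightarrow> real. x \<longlonglongrightarrow> 0}"
    by (simp add: subspace_def plus_fun_def zero_fun_def scaleR_fun_def)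
qed

lemma locally_convex_lp_p:
  assumes "1 \<le> p"
  shows "locally_convex_space (lp_p p)"
  unfolding lp_p_def
proof (intro locally_convex_pointwise)
  have scale: "summable (\<lambda>n. \<bar>c * x n\<bar> powr p)" if "summable (\<lambda>n. \<bar>x n\<bar> powr p)"
    for c and x :: "nat \<Rightarrow> real"
    using summable_mult[OF that, of "\<bar>c\<bar> powr p"] by (simp add: abs_mult powr_mult)
  have add: "summable (\<lambda>n. \<bar>x n + y n\<bar> powr p)"
    if "summable (\<lambda>n. \<bar>x n\<bar> powr p)" "summable (\<lambda>n. \<bar>y n\<bar> powr p)" for x y :: "nat \<Rightarrow> real"
  proof (rule summable_comparison_test')
    show "summable (\<lambda>n. 2 powr p * (\<bar>x n\<bar> powr p + \<bar>y n\<bar> powr p))"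
      by (intro summable_mult summable_add that)
    fix n
    have "\<bar>x n + y n\<bar> powr p \<le> (2 * max \<bar>x n\<bar> \<bar>y n\<bar>) powr p"
      using assms by (intro powr_mono2) auto
    also have "\<dots> = 2 powr p * max \<bar>x n\<bar> \<bar>y n\<bar> powr p"
      by (simp add: powr_mult)
    also have "\<dots> \<le> 2 powr p * (\<bar>x n\<bar> powr p + \<bar>y n\<bar> powr p)"
      by (intro mult_left_mono) (auto simp: max_def)
    finally show "norm (\<bar>x n + y n\<bar> powr p) \<le> 2 powr p * (\<bar>x n\<bar> powr p + \<bar>y n\<bar> powr p)"
      by simp
  qed
  show "subspace {x. summable (\<lambda>n. \<bar>x n\<bar> powr p)}"
    using scale add by (simp add: subspace_def)
qed

end

theory Submission
  imports Defs
begin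

text \<open>
  The coordinates of \<open>Q\<close> are finitely supported signed measures \<open>\<mu>\<^sub>n\<close> that converge to zero at every
  continuous function.  Pointwise boundedness forces every continuous function to be bounded on the
  union of their supports, so if the norms \<open>\<parallel>\<mu>\<^sub>n\<parallel>\<close> tended to zero, then the coordinates of \<open>Q f\<close> would
  decay at a rate independent of \<open>f\<close> up to a constant, contradicting surjectivity.  Hence a normalised
  subsequence of \<open>\<mu>\<^sub>n\<close> still converges to zero pointwise, but not uniformly on the unit ball of
  bounded functions, which is barrel-bounded by a Baire category argument.

  For the quotient, a gliding hump argument selects a further subsequence and functions \<open>f\<^sub>k\<close> with
  disjoint supports such that the matrix \<open>\<mu>\<^sub>k(f\<^sub>j)\<close> is lower triangular with a dominating diagonal.
  Solving the triangular system yields a map onto \<open>(c\<^sub>0)\<^sub>p\<close> with the continuous linear right inverse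
  \<open>y \<mapsto> \<Sum>\<^sub>k y\<^sub>k f\<^sub>k\<close>, and therefore an open one.
\<close>

section \<open>Continuous functions and continuous functionals\<close>

lemma topspace_Cp:
  "topspace (Cp X) = {f. continuous_map X euclideanreal f \<and> (\<forall>x. x \<notin> topspace X \<longrightarrow> f x = 0)}"
  by (simp add: Cp_def)

lemma Cp_pointwise: "Cp X = pointwise_topology (topspace (Cp X))"
  by (simp add: Cp_def)

lemma Cp_memD:
  assumes "f \<in> topspace (Cp X)"
  shows "continuous_map X euclideanreal f" "x \<notin> topspace X \<Longrightarrow> f x = 0"
  using assms by (auto simp: topspace_Cp)

lemma Cp_memI:
  assumes "continuous_map X euclideanreal f" "\<And>x. x \<notin> topspace X \<Longrightarrow> f x = 0"
  shows "f \<in> topspace (Cp X)"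
  using assms by (auto simp: topspace_Cp)

lemma subspace_Cp: "subspace (topspace (Cp X))"
  using locally_convex_Cp unfolding locally_convex_space_def by blast

lemma Cp_add: "f \<in> topspace (Cp X) \<Longrightarrow> g \<in> topspace (Cp X) \<Longrightarrow> (\<lambda>x. f x + g x) \<in> topspace (Cp X)"
  by (auto simp: topspace_Cp intro: continuous_map_add)

lemma Cp_diff: "f \<in> topspace (Cp X) \<Longrightarrow> g \<in> topspace (Cp X) \<Longrightarrow> (\<lambda>x. f x - g x) \<in> topspace (Cp X)"
  by (auto simp: topspace_Cp intro: continuous_map_diff)

lemma Cp_cmult: "f \<in> topspace (Cp X) \<Longrightarrow> (\<lambda>x. c * f x) \<in> topspace (Cp X)"
  by (auto simp: topspace_Cp intro: continuous_map_real_mult_left)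

lemma Cp_zero: "(\<lambda>x. 0) \<in> topspace (Cp X)"
  by (auto simp: topspace_Cp)

lemma Cp_sum:
  "finite I \<Longrightarrow> (\<And>i. i \<in> I \<Longrightarrow> f i \<in> topspace (Cp X)) \<Longrightarrow> (\<lambda>x. \<Sum>i\<in>I. f i x) \<in> topspace (Cp X)"
  by (auto simp: topspace_Cp intro: continuous_map_sum)

lemma closedin_Cp_le:
  assumes "f \<in> topspace (Cp X)"
  shows "closedin X {x \<in> topspace X. f x \<le> r}"
  using closedin_continuous_map_preimage[OF Cp_memD(1)[OF assms], of "{..r}"] by simp

section \<open>Separation and interpolation by continuous functions\<close>

lemma tychonoff_separation:
  assumes "tychonoff_space X" "closedin X C" "x \<in> topspace X" "x \<notin> C"
  shows "\<exists>h\<in>topspace (Cp X). h x = 1 \<and> (\<forall>y\<in>C. h y = 0)"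
proof -
  obtain f where f: "continuous_map X euclideanreal f" "f x = 0" "f ` C \<subseteq> {1}"
    using assms unfolding tychonoff_space_def completely_regular_space_alt by (metis DiffI)
  define h where "h = (\<lambda>y. if y \<in> topspace X then 1 - f y else 0)"
  have "continuous_map X euclideanreal h"
    by (rule continuous_map_eq[of _ _ "\<lambda>y. 1 - f y"])
       (auto simp: h_def intro!: continuous_map_diff f)
  then have "h \<in> topspace (Cp X)" by (intro Cp_memI) (auto simp: h_def)
  moreover have "h x = 1" using f assms by (simp add: h_def)
  moreover have "\<forall>y\<in>C. h y = 0" using f(3) by (auto simp: h_def)
  ultimately show ?thesis by blast
qed

lemma tychonoff_finite_closed:
  assumes "tychonoff_space X" "finite B" "B \<subseteq> topspace X"
  shows "closedin X B"
  using assms unfolding tychonoff_space_def by (auto intro: closedin_Hausdorff_finite)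

text \<open>Each \<open>b\<close> is separated from \<open>C \<union> (B - {b})\<close>, which is
  closed because finite sets are closed in a Hausdorff space.\<close>

lemma tychonoff_dual_basis:
  assumes X: "tychonoff_space X" and C: "closedin X C" and B: "finite B" "B \<subseteq> topspace X" "B \<inter> C = {}"
  obtains h where "\<And>b. b \<in> B \<Longrightarrow> h b \<in> topspace (Cp X)" "\<And>b. b \<in> B \<Longrightarrow> h b b = 1"
    "\<And>a b. a \<in> B \<Longrightarrow> b \<in> B \<Longrightarrow> a \<noteq> b \<Longrightarrow> h b a = 0" "\<And>b y. b \<in> B \<Longrightarrow> y \<in> C \<Longrightarrow> h b y = 0"
proof -
  have "\<forall>b\<in>B. \<exists>h\<in>topspace (Cp X). h b = 1 \<and> (\<forall>y\<in>C \<union> (B - {b}). h y = 0)"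
  proof
    fix b assume "b \<in> B"
    then show "\<exists>h\<in>topspace (Cp X). h b = 1 \<and> (\<forall>y\<in>C \<union> (B - {b}). h y = 0)"
      using B by (intro tychonoff_separation[OF X] closedin_Un[OF C] tychonoff_finite_closed[OF X]) auto
  qed
  then obtain h where "\<forall>b\<in>B. h b \<in> topspace (Cp X) \<and> h b b = 1 \<and> (\<forall>y\<in>C \<union> (B - {b}). h b y = 0)"
    by metis
  then show ?thesis by (intro that[of h]) auto
qed

lemma tychonoff_interpolation:
  fixes s :: "'a \<Rightarrow> real"
  assumes X: "tychonoff_space X" and C: "closedin X C" and B: "finite B" "B \<subseteq> topspace X" "B \<inter> C = {}"
  shows "\<exists>f\<in>topspace (Cp X). (\<forall>b\<in>B. f b = s b) \<and> (\<forall>y\<in>C. f y = 0)"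
proof -
  obtain h where h: "\<And>b. b \<in> B \<Longrightarrow> h b \<in> topspace (Cp X)" "\<And>b. b \<in> B \<Longrightarrow> h b b = 1"
    "\<And>a b. a \<in> B \<Longrightarrow> b \<in> B \<Longrightarrow> a \<noteq> b \<Longrightarrow> h b a = 0" "\<And>b y. b \<in> B \<Longrightarrow> y \<in> C \<Longrightarrow> h b y = 0"
    using tychonoff_dual_basis[OF X C B] by blast
  let ?f = "\<lambda>x. \<Sum>b\<in>B. s b * h b x"
  have "?f \<in> topspace (Cp X)" by (intro Cp_sum Cp_cmult h B)
  moreover have "?f a = s a" if "a \<in> B" for a
  proof -
    have "?f a = (\<Sum>b\<in>B. if b = a then s a else 0)"
      using h(2,3) that by (intro sum.cong) auto
    then show ?thesis using B that by simp
  qed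
  moreover have "?f y = 0" if "y \<in> C" for y
    using h(4) that by (simp add: sum.neutral)
  ultimately show ?thesis by (intro bexI[of _ ?f]) auto
qed

text \<open>Clipping an interpolating function to \<open>[-1, 1]\<close> changes neither its zeros
  on \<open>C\<close> nor the prescribed values, which lie in that interval.\<close>

lemma tychonoff_bounded_interpolation:
  fixes s :: "'a \<Rightarrow> real"
  assumes X: "tychonoff_space X" and C: "closedin X C" and B: "finite B" "B \<subseteq> topspace X" "B \<inter> C = {}"
    and s: "\<And>b. b \<in> B \<Longrightarrow> \<bar>s b\<bar> \<le> 1"
  shows "\<exists>f\<in>topspace (Cp X). (\<forall>x. \<bar>f x\<bar> \<le> 1) \<and> (\<forall>b\<in>B. f b = s b) \<and> (\<forall>y\<in>C. f y = 0)"
proof -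
  obtain f where f: "f \<in> topspace (Cp X)" "\<And>b. b \<in> B \<Longrightarrow> f b = s b" "\<And>y. y \<in> C \<Longrightarrow> f y = 0"
    using tychonoff_interpolation[OF X C B, of s] by blast
  let ?g = "\<lambda>x. max (- 1) (min 1 (f x))"
  have "?g \<in> topspace (Cp X)"
    using Cp_memD[OF f(1)]
    by (intro Cp_memI continuous_map_real_max continuous_map_real_min) auto
  moreover have "?g b = s b" if "b \<in> B" for b using s[OF that] f(2)[OF that] by auto
  ultimately show ?thesis using f(3) by (intro bexI[of _ ?g]) auto
qed

text \<open>The estimate ranges over the whole type, so the limit inherits both continuity and the
  convention of vanishing off \<open>topspace X\<close>.\<close>

lemma uniform_limit_Cp:
  assumes f: "\<And>n. f n \<in> topspace (Cp X)"
    and lim: "\<And>e. e > 0 \<Longrightarrow> \<forall>\<^sub>F n in sequentially. \<forall>x. \<bar>f n x - g x\<bar> < e"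
  shows "g \<in> topspace (Cp X)"
proof (rule Cp_memI)
  have "continuous_map X (Met_TC.mtopology :: real topology) g"
  proof (rule Met_TC.continuous_map_uniform_limit[where f = f and F = sequentially])
    show "\<forall>\<^sub>F n in sequentially. continuous_map X Met_TC.mtopology (f n)"
      using Cp_memD(1)[OF f] by simp
    show "\<forall>\<^sub>F n in sequentially. \<forall>x\<in>topspace X. g x \<in> UNIV \<and> dist (f n x) (g x) < e" if "e > 0" for e
      using lim[OF that] by eventually_elim (auto simp: dist_real_def)
  qed auto
  then show "continuous_map X euclideanreal g" by simp
next
  fix x assume x: "x \<notin> topspace X"
  show "g x = 0"
  proof (rule ccontr)
    assume "g x \<noteq> 0"
    then obtain n where "\<bar>f n x - g x\<bar> < \<bar>g x\<bar>"
      using eventually_happens'[OF _ lim[of "\<bar>g x\<bar>"]] by auto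
    then show False using Cp_memD(2)[OF f x, of n] by simp
  qed
qed

text \<open>A basic open set restricts only finitely many coordinates, so one radius serves all of
  them.\<close>

lemma pointwise_topology_nhd:
  assumes U: "openin (pointwise_topology Y) U" and f: "f \<in> U"
  shows "\<exists>F e. finite F \<and> e > 0 \<and> (\<forall>g\<in>Y. (\<forall>x\<in>F. \<bar>g x - f x\<bar> < e) \<longrightarrow> g \<in> U)"
proof -
  obtain W where W: "openin (product_topology (\<lambda>_. euclideanreal) UNIV) W" and U': "U = W \<inter> Y"
    using U unfolding pointwise_topology_def openin_subtopology by auto
  with f obtain A where A: "finite {i. A i \<noteq> UNIV}" "\<And>i. open (A i)" "f \<in> PiE UNIV A" "PiE UNIV A \<subseteq> W"
    unfolding openin_product_topology_alt by (auto simp: Pi_iff)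
  have "\<exists>e>0. ball (f i) e \<subseteq> A i" for i
    using A(2)[of i] A(3) by (auto simp: open_contains_ball PiE_iff)
  then obtain e where e: "\<And>i. e i > 0" "\<And>i. ball (f i) (e i) \<subseteq> A i" by metis
  define F where "F = {i. A i \<noteq> UNIV}"
  \<comment> \<open>The inserted \<open>1\<close> gives a positive radius even when \<open>F\<close>
    is empty.\<close>
  define d where "d = Min (insert 1 (e ` F))"
  have finF: "finite F" using A(1) by (simp add: F_def)
  have d: "d > 0" "\<And>i. i \<in> F \<Longrightarrow> d \<le> e i"
    using finF e(1) by (auto simp: d_def)
  have "g \<in> U" if g: "g \<in> Y" "\<forall>x\<in>F. \<bar>g x - f x\<bar> < d" for g
  proof -
    have "g i \<in> A i" for i
    proof (cases "i \<in> F")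
      case True
      then have "g i \<in> ball (f i) (e i)"
        using g(2) d(2)[OF True] by (auto simp: dist_real_def abs_minus_commute)
      then show ?thesis using e(2) by blast
    qed (auto simp: F_def)
    then show ?thesis using A(4) U' g(1) by (auto simp: PiE_iff)
  qed
  then show ?thesis using finF d(1) by blast
qed

section \<open>Continuous functionals on \<open>Cp X\<close> as finitely supported measures\<close>

lemma limitin_Cp:
  "limitin (Cp X) s l sequentially \<longleftrightarrow>
     l \<in> topspace (Cp X) \<and> (\<forall>\<^sub>F n in sequentially. s n \<in> topspace (Cp X)) \<and>
     (\<forall>x. (\<lambda>n. s n x) \<longlonglongrightarrow> l x)"
  unfolding Cp_def limitin_pointwise topspace_pointwise ..

lemma continuous_map_into_Cp:
  "continuous_map Z (Cp X) G \<longleftrightarrow>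
     (\<forall>z\<in>topspace Z. G z \<in> topspace (Cp X)) \<and> (\<forall>x. continuous_map Z euclideanreal (\<lambda>z. G z x))"
  unfolding Cp_def continuous_map_into_pointwise topspace_pointwise ..

text \<open>In contrast to \<open>top_dual\<close>, no value is prescribed off the space, so that
  sums of point evaluations qualify as they stand.\<close>

definition continuous_functional :: "'a topology \<Rightarrow> (('a \<Rightarrow> real) \<Rightarrow> real) \<Rightarrow> bool" where
  "continuous_functional X \<phi> \<longleftrightarrow>
     linear_map_on (topspace (Cp X)) \<phi> \<and> continuous_map (Cp X) euclideanreal \<phi>"

text \<open>Integration of \<open>f\<close> against the finitely supported signed measure with mass
  \<open>c x\<close> at each \<open>x\<close> in \<open>A\<close>.\<close>

definition evaluation :: "'a set \<Rightarrow> ('a \<Rightarrow> real) \<Rightarrow> ('a \<Rightarrow> real) \<Rightarrow> real" where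
  "evaluation A c f = (\<Sum>x\<in>A. c x * f x)"

lemma continuous_functional_evaluation:
  assumes "finite A"
  shows "continuous_functional X (evaluation A c)"
  unfolding continuous_functional_def evaluation_def
proof
  show "linear_map_on (topspace (Cp X)) (\<lambda>f. \<Sum>x\<in>A. c x * f x)"
    by (auto simp: linear_map_on_def sum.distrib sum_distrib_left algebra_simps)
  show "continuous_map (Cp X) euclideanreal (\<lambda>f. \<Sum>x\<in>A. c x * f x)"
    unfolding Cp_def
    by (intro continuous_map_sum assms continuous_map_real_mult_left continuous_map_coordinate)
qed

lemma linear_map_onD:
  assumes "linear_map_on (topspace (Cp X)) \<phi>"
  shows "f \<in> topspace (Cp X) \<Longrightarrow> g \<in> topspace (Cp X) \<Longrightarrow> \<phi> (\<lambda>x. f x + g x) = \<phi> f + \<phi> g"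
    and "f \<in> topspace (Cp X) \<Longrightarrow> \<phi> (\<lambda>x. c * f x) = c *\<^sub>R \<phi> f"
  using assms unfolding linear_map_on_def plus_fun_def scaleR_fun_def by auto

lemma linear_map_on_diff:
  assumes "linear_map_on (topspace (Cp X)) \<phi>" "f \<in> topspace (Cp X)" "g \<in> topspace (Cp X)"
  shows "\<phi> (\<lambda>x. f x - g x) = \<phi> f - \<phi> g"
  using linear_map_onD(1)[OF assms(1,2) Cp_cmult[OF assms(3)], of "- 1"]
    linear_map_onD(2)[OF assms(1,3), of "- 1"] by simp

lemma linear_map_on_zero:
  assumes "linear_map_on (topspace (Cp X)) \<phi>"
  shows "\<phi> (\<lambda>x. 0) = 0"
  using linear_map_onD(2)[OF assms Cp_zero, of 0] by simp

lemma linear_map_on_sum: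
  assumes \<phi>: "linear_map_on (topspace (Cp X)) \<phi>" and "finite I"
    and "\<And>i. i \<in> I \<Longrightarrow> f i \<in> topspace (Cp X)"
  shows "\<phi> (\<lambda>x. \<Sum>i\<in>I. c i * f i x) = (\<Sum>i\<in>I. c i *\<^sub>R \<phi> (f i))"
  using assms(2,3)
proof (induction I)
  case empty
  then show ?case using linear_map_on_zero[OF \<phi>] by simp
next
  case (insert i I)
  then show ?case
    using linear_map_onD(1)[OF \<phi> Cp_cmult Cp_sum, of "f i" I "\<lambda>j x. c j * f j x" "c i"]
    by (simp add: Cp_cmult linear_map_onD(2)[OF \<phi>])
qed

text \<open>Continuity at zero bounds \<open>\<phi>\<close> on all functions that are small on some
  finite set. Scaling then forces \<open>\<phi>\<close> to vanish on functions that are zero on that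
  set, so it is a combination of evaluations there. Dropping the zero coefficients makes
  \<open>A\<close> the exact support, as \<open>supports_bounded\<close> requires.\<close>

lemma continuous_functional_representation:
  assumes X: "tychonoff_space X" and \<phi>: "continuous_functional X \<phi>"
  obtains A c where "finite A" "A \<subseteq> topspace X" "\<And>x. x \<in> A \<Longrightarrow> c x \<noteq> 0"
    "\<And>f. f \<in> topspace (Cp X) \<Longrightarrow> \<phi> f = evaluation A c f"
proof -
  have lin: "linear_map_on (topspace (Cp X)) \<phi>" and cont: "continuous_map (Cp X) euclideanreal \<phi>"
    using \<phi> unfolding continuous_functional_def by auto
  let ?U = "{f \<in> topspace (Cp X). \<phi> f \<in> ball 0 1}"
  have "openin (Cp X) ?U" by (rule openin_continuous_map_preimage[OF cont]) simp
  moreover have "(\<lambda>x. 0) \<in> ?U" using Cp_zero linear_map_on_zero[OF lin] by auto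
  ultimately obtain F e where F: "finite F" "e > 0"
    and Fe: "\<And>g. g \<in> topspace (Cp X) \<Longrightarrow> (\<forall>x\<in>F. \<bar>g x\<bar> < e) \<Longrightarrow> \<bar>\<phi> g\<bar> < 1"
    using pointwise_topology_nhd[of "topspace (Cp X)" ?U "\<lambda>x. 0"] unfolding Cp_pointwise[symmetric]
    by auto
  define B where "B = F \<inter> topspace X"
  have B: "finite B" "B \<subseteq> topspace X" using F by (auto simp: B_def)
  have ker: "\<phi> g = 0" if g: "g \<in> topspace (Cp X)" "\<And>x. x \<in> B \<Longrightarrow> g x = 0" for g
  proof (rule ccontr)
    assume nz: "\<phi> g \<noteq> 0"
    have g0: "g x = 0" if "x \<in> F" for x
      using that g(2) Cp_memD(2)[OF g(1), of x] by (cases "x \<in> topspace X") (auto simp: B_def)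
    \<comment> \<open>All multiples of \<open>g\<close> vanish on \<open>F\<close>, including the
      one on which \<open>\<phi>\<close> takes the value 1.\<close>
    have "\<bar>\<phi> (\<lambda>x. (1 / \<phi> g) * g x)\<bar> < 1"
      using F(2) g0 by (intro Fe Cp_cmult g) simp
    then show False using linear_map_onD(2)[OF lin g(1), of "1 / \<phi> g"] nz by simp
  qed
  obtain h where h: "\<And>b. b \<in> B \<Longrightarrow> h b \<in> topspace (Cp X)" "\<And>b. b \<in> B \<Longrightarrow> h b b = 1"
    "\<And>a b. a \<in> B \<Longrightarrow> b \<in> B \<Longrightarrow> a \<noteq> b \<Longrightarrow> h b a = 0"
    using tychonoff_dual_basis[OF X closedin_empty B] by auto
  have rep: "\<phi> f = (\<Sum>b\<in>B. \<phi> (h b) * f b)" if f: "f \<in> topspace (Cp X)" for f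
  proof -
    \<comment> \<open>\<open>?g\<close> agrees with \<open>f\<close> on \<open>B\<close>, so
      \<open>ker\<close> applies to their difference.\<close>
    let ?g = "\<lambda>x. \<Sum>b\<in>B. f b * h b x"
    have g: "?g \<in> topspace (Cp X)" by (intro Cp_sum Cp_cmult h B)
    have "?g a = f a" if "a \<in> B" for a
    proof -
      have "?g a = (\<Sum>b\<in>B. if b = a then f a else 0)"
        using h(2,3) that by (intro sum.cong) auto
      then show ?thesis using B that by simp
    qed
    then have "\<phi> (\<lambda>x. f x - ?g x) = 0"
      by (intro ker Cp_diff f g) simp
    then have "\<phi> f = \<phi> ?g" using linear_map_on_diff[OF lin f g] by simp
    also have "\<dots> = (\<Sum>b\<in>B. f b * \<phi> (h b))"
      using linear_map_on_sum[OF lin B(1) h(1), where c = f] by simp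
    finally show ?thesis by (simp add: mult.commute)
  qed
  show ?thesis
  proof (rule that[of "{b \<in> B. \<phi> (h b) \<noteq> 0}" "\<lambda>b. \<phi> (h b)"])
    fix f assume f: "f \<in> topspace (Cp X)"
    have "(\<Sum>b\<in>B. \<phi> (h b) * f b) = (\<Sum>b\<in>{b \<in> B. \<phi> (h b) \<noteq> 0}. \<phi> (h b) * f b)"
      by (rule sum.mono_neutral_right[OF B(1)]) auto
    then show "\<phi> f = evaluation {b \<in> B. \<phi> (h b) \<noteq> 0} (\<lambda>b. \<phi> (h b)) f"
      using rep[OF f] by (simp add: evaluation_def)
  qed (use B in auto)
qed

section \<open>Pointwise bounded sequences of measures\<close>

lemma Cp_abs: "f \<in> topspace (Cp X) \<Longrightarrow> (\<lambda>x. \<bar>f x\<bar>) \<in> topspace (Cp X)"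
  by (auto simp: topspace_Cp intro: continuous_map_real_abs)

text \<open>
  If \<open>g\<close> is unbounded on the supports, then \<open>f\<close> is built by successive corrections: at each stage
  the value of some later measure is set to \<open>k\<close> by changing the function only where \<open>\<bar>g\<bar>\<close> is
  larger than on the supports already used.  So \<open>f\<close> is locally equal to one of the stages.
\<close>

lemma supports_bounded:
  fixes A :: "nat \<Rightarrow> 'a set"
  assumes X: "tychonoff_space X"
    and A: "\<And>n. finite (A n)" "\<And>n. A n \<subseteq> topspace X" "\<And>n x. x \<in> A n \<Longrightarrow> c n x \<noteq> 0"
    and bdd: "\<And>f. f \<in> topspace (Cp X) \<Longrightarrow> \<exists>K. \<forall>n. \<bar>evaluation (A n) (c n) f\<bar> \<le> K"
    and g: "g \<in> topspace (Cp X)"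
  shows "\<exists>K. \<forall>n. \<forall>x\<in>A n. \<bar>g x\<bar> \<le> K"
proof (rule ccontr)
  assume "\<not> ?thesis"
  then have unb: "\<exists>n. \<exists>x\<in>A n. \<bar>g x\<bar> > K" for K by (meson not_le)
  have G: "(\<lambda>x. \<bar>g x\<bar>) \<in> topspace (Cp X)" by (rule Cp_abs[OF g])
  \<comment> \<open>A state consists of the current function and a level: where |g| is at most that
    level, all later functions keep the current values.\<close>
  define P where "P = (\<lambda>s::('a \<Rightarrow> real) \<times> real. fst s \<in> topspace (Cp X) \<and> 0 \<le> snd s)"
  define Q where "Q = (\<lambda>k s s'. snd s + 1 \<le> snd s' \<and> (\<forall>x. \<bar>g x\<bar> \<le> snd s \<longrightarrow> fst s' x = fst s x) \<and>
      (\<exists>n. (\<forall>x\<in>A n. \<bar>g x\<bar> \<le> snd s') \<and> evaluation (A n) (c n) (fst s') = real k))"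
  have "\<exists>s. \<forall>k. P (s k) \<and> Q k (s k) (s (Suc k))"
  proof (rule dependent_nat_choice)
    show "\<exists>s. P s" unfolding P_def by (rule exI[of _ "(\<lambda>x. 0, 0)"]) (simp add: Cp_zero)
    fix s k assume s: "P s"
    obtain F r where Fr: "s = (F, r)" by fastforce
    have F: "F \<in> topspace (Cp X)" and r: "0 \<le> r" using s by (auto simp: P_def Fr)
    obtain n a where a: "a \<in> A n" "\<bar>g a\<bar> > r" using unb by blast
    let ?C = "{x \<in> topspace X. \<bar>g x\<bar> \<le> r} \<union> (A n - {a})"
    have "closedin X ?C"
      using A by (intro closedin_Un closedin_Cp_le[OF G] tychonoff_finite_closed[OF X]) auto
    then obtain h where h: "h \<in> topspace (Cp X)" "h a = 1" "\<forall>y\<in>?C. h y = 0"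
      using tychonoff_separation[OF X, of ?C a] a A(2) by fastforce
    \<comment> \<open>On \<open>A n\<close> the function \<open>h\<close> is nonzero only at
      \<open>a\<close>, where the coefficient is nonzero. Adding \<open>t * h\<close> thus moves the
      value of the measure exactly to \<open>k\<close>.\<close>
    define t where "t = (real k - evaluation (A n) (c n) F) / c n a"
    define F' where "F' = (\<lambda>x. F x + t * h x)"
    \<comment> \<open>The new level covers all of \<open>A n\<close>, so later corrections cannot
      change the value just achieved.\<close>
    define r' where "r' = Max (insert (r + 1) ((\<lambda>x. \<bar>g x\<bar>) ` A n))"
    have "evaluation (A n) (c n) h = (\<Sum>x\<in>A n. if x = a then c n a else 0)"
      unfolding evaluation_def using h(2,3) by (intro sum.cong) auto
    then have eh: "evaluation (A n) (c n) h = c n a" using a(1) A(1) by simp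
    have "evaluation (A n) (c n) F' = evaluation (A n) (c n) F + t * evaluation (A n) (c n) h"
      by (simp add: evaluation_def F'_def sum.distrib sum_distrib_left algebra_simps)
    also have "\<dots> = real k" using A(3)[OF a(1)] by (simp add: eh t_def)
    finally have eF: "evaluation (A n) (c n) F' = real k" .
    have r': "r + 1 \<le> r'" "\<forall>x\<in>A n. \<bar>g x\<bar> \<le> r'" using A(1) by (auto simp: r'_def)
    have "F' x = F x" if "\<bar>g x\<bar> \<le> r" for x
      using that h(3) Cp_memD(2)[OF h(1), of x] by (cases "x \<in> topspace X") (auto simp: F'_def)
    then have "P (F', r') \<and> Q k s (F', r')"
      unfolding P_def Q_def Fr using r r' eF by (auto simp: F'_def intro!: Cp_add Cp_cmult F h)
    then show "\<exists>s'. P s' \<and> Q k s s'" by blast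
  qed
  then obtain s where s: "\<And>k. P (s k)" "\<And>k. Q k (s k) (s (Suc k))" by blast
  define F where "F = (\<lambda>k. fst (s k))"
  define r where "r = (\<lambda>k. snd (s k))"
  have F: "F k \<in> topspace (Cp X)" for k using s(1) by (simp add: P_def F_def)
  have r_step: "r k + 1 \<le> r (Suc k)" for k using s(2)[of k] by (simp add: Q_def r_def)
  have F_step: "F (Suc k) x = F k x" if "\<bar>g x\<bar> \<le> r k" for k x
    using s(2)[of k] that by (auto simp: Q_def F_def r_def)
  have ev: "\<exists>n. (\<forall>x\<in>A n. \<bar>g x\<bar> \<le> r (Suc k)) \<and> evaluation (A n) (c n) (F (Suc k)) = real k" for k
    using s(2)[of k] by (simp add: Q_def F_def r_def)
  have r_mono: "r k \<le> r j" if "k \<le> j" for k j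
    by (rule lift_Suc_mono_le[OF _ that]) (use r_step in \<open>smt (verit)\<close>)
  have r_ge: "real k \<le> r k" for k
  proof (induction k)
    case 0 then show ?case using s(1)[of 0] by (simp add: P_def r_def)
  next
    case (Suc k) then show ?case using r_step[of k] by simp
  qed
  have F_stab: "F j x = F k x" if "\<bar>g x\<bar> \<le> r k" "k \<le> j" for j k x
    using that(2)
  proof (induction j rule: dec_induct)
    case (step j)
    have "\<bar>g x\<bar> \<le> r j" using that(1) r_mono[OF step(1)] by simp
    then show ?case using F_step step by simp
  qed simp
  have ex: "\<exists>k. \<bar>g x\<bar> < r k" for x
    using reals_Archimedean2[of "\<bar>g x\<bar>"] r_ge by (meson less_le_trans)
  \<comment> \<open>From the first level that reaches |g x| onwards, the stages no longer change at
    \<open>x\<close>.\<close>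
  define f where "f x = F (LEAST k. \<bar>g x\<bar> \<le> r k) x" for x
  have f_eq: "f x = F k x" if "\<bar>g x\<bar> \<le> r k" for k x
  proof -
    have "\<bar>g x\<bar> \<le> r (LEAST k. \<bar>g x\<bar> \<le> r k)" using that by (rule LeastI)
    moreover have "(LEAST k. \<bar>g x\<bar> \<le> r k) \<le> k" using that by (rule Least_le)
    ultimately show ?thesis unfolding f_def using F_stab by metis
  qed
  have "f \<in> topspace (Cp X)"
  proof (rule Cp_memI)
    show "continuous_map X euclideanreal f"
      unfolding continuous_map_def
    proof (intro conjI allI impI)
      fix W :: "real set" assume W: "openin euclideanreal W"
      \<comment> \<open>The open sets where |g| is below \<open>r k\<close> cover the space, and on
        each of them \<open>f\<close> coincides with the continuous \<open>F k\<close>.\<close>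
      have "{x \<in> topspace X. f x \<in> W} =
          (\<Union>k. {x \<in> topspace X. \<bar>g x\<bar> \<in> {..<r k}} \<inter> {x \<in> topspace X. F k x \<in> W})"
        using ex by (auto simp: f_eq[OF less_imp_le]) (metis f_eq less_imp_le)
      also have "openin X \<dots>"
      proof (rule openin_Union, clarify)
        fix k
        show "openin X ({x \<in> topspace X. \<bar>g x\<bar> \<in> {..<r k}} \<inter> {x \<in> topspace X. F k x \<in> W})"
          by (intro openin_Int openin_continuous_map_preimage[OF Cp_memD(1)[OF G]]
              openin_continuous_map_preimage[OF Cp_memD(1)[OF F] W]) simp
      qed
      finally show "openin X {x \<in> topspace X. f x \<in> W}" .
    qed auto
    show "f x = 0" if "x \<notin> topspace X" for x
      using Cp_memD(2)[OF F that] by (simp add: f_def)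
  qed
  then obtain K where K: "\<And>n. \<bar>evaluation (A n) (c n) f\<bar> \<le> K" using bdd by blast
  obtain k :: nat where k: "real k > K" using reals_Archimedean2 by blast
  obtain n where n: "\<forall>x\<in>A n. \<bar>g x\<bar> \<le> r (Suc k)" "evaluation (A n) (c n) (F (Suc k)) = real k"
    using ev by blast
  have "evaluation (A n) (c n) f = evaluation (A n) (c n) (F (Suc k))"
    unfolding evaluation_def using n(1) f_eq by (intro sum.cong) auto
  then show False using K[of n] n(2) k by simp
qed

text \<open>The description of the property by measures. Each point occurs once in
  \<open>A n\<close>, so the sum of the absolute coefficients is the total variation.\<close>

definition JN_sequence ::
    "'a topology \<Rightarrow> (nat \<Rightarrow> 'a set) \<Rightarrow> (nat \<Rightarrow> 'a \<Rightarrow> real) \<Rightarrow> bool" where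
  "JN_sequence X A c \<longleftrightarrow>
     (\<forall>n. finite (A n) \<and> A n \<subseteq> topspace X \<and> (\<Sum>x\<in>A n. \<bar>c n x\<bar>) = 1) \<and>
     (\<forall>f\<in>topspace (Cp X). (\<lambda>n. evaluation (A n) (c n) f) \<longlonglongrightarrow> 0)"

section \<open>Coordinate measures of a surjection onto \<open>lp_p p\<close>\<close>

lemma evaluation_le:
  assumes "\<And>x. x \<in> A \<Longrightarrow> \<bar>f x\<bar> \<le> K"
  shows "\<bar>evaluation A c f\<bar> \<le> K * (\<Sum>x\<in>A. \<bar>c x\<bar>)"
proof -
  have "\<bar>evaluation A c f\<bar> \<le> (\<Sum>x\<in>A. \<bar>c x * f x\<bar>)" unfolding evaluation_def by (rule sum_abs)
  also have "\<dots> \<le> (\<Sum>x\<in>A. K * \<bar>c x\<bar>)"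
    using assms by (intro sum_mono) (metis abs_ge_zero abs_mult mult.commute mult_right_mono)
  finally show ?thesis by (simp add: sum_distrib_left)
qed

text \<open>
  If the total variations of the coordinate measures tended to zero, there would be an element of
  \<open>\<ell>\<^sub>p\<close> whose coordinates are much larger along a subsequence; it is not in the range, because
  every continuous function is bounded on the union of the supports.
\<close>

lemma surjection_onto_lp_gives_JN_sequence:
  assumes X: "tychonoff_space X" and p: "1 \<le> p"
    and Q: "continuous_linear_surjection (Cp X) (lp_p p) Q"
  obtains A c where "JN_sequence X A c"
proof -
  have lin: "linear_map_on (topspace (Cp X)) Q" and cont: "continuous_map (Cp X) (lp_p p) Q"
    and onto: "Q ` topspace (Cp X) = {x. summable (\<lambda>n. \<bar>x n\<bar> powr p)}"
    using Q unfolding continuous_linear_surjection_def by (auto simp: lp_p_def)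
  have "continuous_functional X (\<lambda>f. Q f n)" for n
    unfolding continuous_functional_def
  proof
    show "linear_map_on (topspace (Cp X)) (\<lambda>f. Q f n)"
      using lin by (auto simp: linear_map_on_def)
    show "continuous_map (Cp X) euclideanreal (\<lambda>f. Q f n)"
      using cont unfolding lp_p_def continuous_map_into_pointwise by blast
  qed
  then have "\<exists>A c. finite A \<and> A \<subseteq> topspace X \<and> (\<forall>x\<in>A. c x \<noteq> 0) \<and>
      (\<forall>f\<in>topspace (Cp X). Q f n = evaluation A c f)" for n
    using continuous_functional_representation[OF X] by metis
  then obtain A c where A: "\<And>n. finite (A n)" "\<And>n. A n \<subseteq> topspace X" "\<And>n x. x \<in> A n \<Longrightarrow> c n x \<noteq> 0"
    and rep: "\<And>n f. f \<in> topspace (Cp X) \<Longrightarrow> Q f n = evaluation (A n) (c n) f"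
    by metis
  have null: "(\<lambda>n. evaluation (A n) (c n) f) \<longlonglongrightarrow> 0" if f: "f \<in> topspace (Cp X)" for f
  proof -
    have "summable (\<lambda>n. \<bar>Q f n\<bar> powr p)" using onto f by auto
    then have "(\<lambda>n. (\<bar>Q f n\<bar> powr p) powr (1 / p)) \<longlonglongrightarrow> 0"
      using p by (intro tendsto_zero_powrI[OF summable_LIMSEQ_zero tendsto_const]) auto
    then have "(\<lambda>n. \<bar>Q f n\<bar>) \<longlonglongrightarrow> 0" using p by (simp add: powr_powr)
    then show ?thesis using rep[OF f] by (simp add: tendsto_rabs_zero_iff)
  qed
  have sb: "\<exists>K. \<forall>n. \<forall>x\<in>A n. \<bar>g x\<bar> \<le> K" if "g \<in> topspace (Cp X)" for g
  proof (rule supports_bounded[OF X A _ that])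
    fix f assume "f \<in> topspace (Cp X)"
    then show "\<exists>K. \<forall>n. \<bar>evaluation (A n) (c n) f\<bar> \<le> K"
      using convergent_imp_Bseq[OF convergentI[OF null]] by (auto simp: Bseq_def)
  qed
  define v where "v n = (\<Sum>x\<in>A n. \<bar>c n x\<bar>)" for n
  have v0: "0 \<le> v n" for n by (simp add: v_def sum_nonneg)
  have "\<exists>\<delta>>0. \<exists>\<^sub>F n in sequentially. \<delta> \<le> v n"
  proof (rule ccontr)
    assume "\<not> ?thesis"
    then have ev: "\<forall>\<^sub>F n in sequentially. v n < \<delta>" if "\<delta> > 0" for \<delta>
      using that by (auto simp: frequently_def not_le)
    have "\<exists>m. \<forall>k. v (m k) < (1 / 4) ^ k \<and> m k < m (Suc k)"
    proof (rule dependent_nat_choice)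
      show "\<exists>n. v n < (1 / 4) ^ 0"
        using eventually_happens'[OF _ ev[of 1]] by auto
      show "\<exists>n'. v n' < (1 / 4) ^ Suc k \<and> n < n'" for n k
        using eventually_happens'[OF _ eventually_conj[OF ev[of "(1/4) ^ Suc k"] eventually_gt_at_top[of n]]]
        by auto
    qed
    then obtain m where m: "\<And>k. v (m k) < (1 / 4) ^ k" "strict_mono m"
      by (auto simp: strict_mono_Suc_iff)
    \<comment> \<open>At \<open>m k\<close> the value is \<open>(1 / 2) ^ k\<close>: this decays
      fast enough for membership in the target space, yet eventually exceeds every fixed multiple of
      \<open>(1 / 4) ^ k\<close>.\<close>
    define y where "y n = (if n \<in> range m then (1 / 2) ^ (inv m n) else 0 :: real)" for n
    have y_m: "y (m k) = (1 / 2) ^ k" for k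
      using strict_mono_imp_inj_on[OF m(2)] by (simp add: y_def)
    have "summable (\<lambda>k. \<bar>y (m k)\<bar> powr p)"
    proof (rule summable_comparison_test')
      show "summable (\<lambda>k. (1 / 2) ^ k :: real)" by (rule summable_geometric) simp
      show "norm (\<bar>y (m k)\<bar> powr p) \<le> (1 / 2) ^ k" for k
        using powr_mono'[of 1 p "(1 / 2) ^ k"] p by (simp add: y_m power_le_one)
    qed
    moreover have "\<bar>y n\<bar> powr p = 0" if "n \<notin> range m" for n using that by (simp add: y_def)
    ultimately have "summable (\<lambda>n. \<bar>y n\<bar> powr p)"
      using summable_mono_reindex[OF m(2), of "\<lambda>n. \<bar>y n\<bar> powr p"] by blast
    then have "y \<in> Q ` topspace (Cp X)" using onto by simp
    then obtain f where f: "f \<in> topspace (Cp X)" "Q f = y" by auto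
    obtain K where K: "\<And>n x. x \<in> A n \<Longrightarrow> \<bar>f x\<bar> \<le> K" using sb[OF f(1)] by blast
    obtain k :: nat where k: "\<bar>K\<bar> < 2 ^ k" using real_arch_pow[of 2 "\<bar>K\<bar>"] by auto
    have "evaluation (A (m k)) (c (m k)) f = (1 / 2) ^ k"
      using rep[OF f(1), of "m k"] by (simp add: f(2) y_m)
    then have "(1 / 2) ^ k = \<bar>evaluation (A (m k)) (c (m k)) f\<bar>" by simp
    also have "\<dots> \<le> K * v (m k)" unfolding v_def by (rule evaluation_le[OF K])
    also have "\<dots> \<le> \<bar>K\<bar> * v (m k)" using v0 by (intro mult_right_mono) auto
    also have "\<dots> \<le> \<bar>K\<bar> * (1 / 4) ^ k" using m(1)[of k] by (intro mult_left_mono) auto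
    also have "\<dots> < 2 ^ k * (1 / 4) ^ k" using k by (intro mult_strict_right_mono) auto
    also have "\<dots> = (1 / 2) ^ k" by (simp flip: power_mult_distrib)
    finally show False by simp
  qed
  then obtain \<delta> where \<delta>: "\<delta> > 0" "\<exists>\<^sub>F n in sequentially. \<delta> \<le> v n" by blast
  then have inf: "infinite {n. \<delta> \<le> v n}" by (simp add: frequently_cofinite flip: cofinite_eq_sequentially)
  define m where "m = enumerate {n. \<delta> \<le> v n}"
  have m: "\<delta> \<le> v (m k)" for k using enumerate_in_set[OF inf] by (auto simp: m_def)
  have sm: "strict_mono m" unfolding m_def by (rule strict_mono_enumerate[OF inf])
  have pos: "v (m k) > 0" for k using m[of k] \<delta>(1) by simp
  show ?thesis
  \<comment> \<open>As \<open>v (m k)\<close> is at least \<open>\<delta>\<close>, normalising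
    multiplies the values by at most \<open>1 / \<delta>\<close>, and they still tend to
    zero.\<close>
  proof (rule that[of "\<lambda>k. A (m k)" "\<lambda>k x. c (m k) x / v (m k)"], unfold JN_sequence_def, intro conjI allI ballI)
    fix k
    show "(\<Sum>x\<in>A (m k). \<bar>c (m k) x / v (m k)\<bar>) = 1"
      using pos[of k] by (simp add: abs_divide v_def flip: sum_divide_distrib)
  next
    fix f assume f: "f \<in> topspace (Cp X)"
    have eq: "evaluation (A (m k)) (\<lambda>x. c (m k) x / v (m k)) f
        = evaluation (A (m k)) (c (m k)) f / v (m k)" for k
      by (simp add: evaluation_def sum_divide_distrib)
    have "(\<lambda>k. evaluation (A (m k)) (c (m k)) f) \<longlonglongrightarrow> 0"
      using LIMSEQ_subseq_LIMSEQ[OF null[OF f] sm] by (simp add: comp_def)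
    then have lim: "(\<lambda>k. evaluation (A (m k)) (c (m k)) f / \<delta>) \<longlonglongrightarrow> 0"
      by (rule tendsto_divide_zero)
    show "(\<lambda>k. evaluation (A (m k)) (\<lambda>x. c (m k) x / v (m k)) f) \<longlonglongrightarrow> 0"
    proof (rule Lim_null_comparison[OF always_eventually])
      show "(\<lambda>k. \<bar>evaluation (A (m k)) (c (m k)) f / \<delta>\<bar>) \<longlonglongrightarrow> 0"
        using lim by (simp only: tendsto_rabs_zero_iff)
      show "\<forall>k. norm (evaluation (A (m k)) (\<lambda>x. c (m k) x / v (m k)) f)
          \<le> \<bar>evaluation (A (m k)) (c (m k)) f / \<delta>\<bar>"
        unfolding eq using m \<delta>(1) pos by (auto simp: abs_divide abs_of_pos[OF pos] intro!: divide_left_mono)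
    qed
  qed (use A in auto)
qed

section \<open>The Josefson-Nissenzweig property\<close>

text \<open>
  A Baire category argument in the sup norm: if no multiple of the barrel \<open>D\<close> contains the unit ball,
  then nested balls avoiding \<open>D\<close>, \<open>2D\<close>, \<open>3D\<close>, ... shrink to a function not absorbed by \<open>D\<close>.
\<close>

lemma unit_ball_barrel_bounded:
  "barrel_bounded (Cp X) {f \<in> topspace (Cp X). \<forall>x. \<bar>f x\<bar> \<le> 1}" (is "barrel_bounded _ ?B")
  unfolding barrel_bounded_def
proof (intro conjI allI impI)
  show "?B \<subseteq> topspace (Cp X)" by auto
  fix D assume "barrel (Cp X) D"
  then have closed: "closedin (Cp X) D" and conv: "convex D"
    and bal: "\<And>c f. \<bar>c\<bar> \<le> 1 \<Longrightarrow> f \<in> D \<Longrightarrow> c *\<^sub>R f \<in> D"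
    and absD: "\<And>f. f \<in> topspace (Cp X) \<Longrightarrow> absorbs D {f}"
    unfolding barrel_def balanced_def by auto
  show "absorbs D ?B"
  proof (rule ccontr)
    assume na: "\<not> absorbs D ?B"
    \<comment> \<open>Since \<open>D\<close> is balanced, one positive multiple of \<open>D\<close>
      containing the ball would already mean absorption.\<close>
    have big: "\<exists>f\<in>?B. (1 / s) *\<^sub>R f \<notin> D" if s: "s > 0" for s
    proof (rule ccontr)
      assume "\<not> ?thesis"
      then have sub: "\<And>f. f \<in> ?B \<Longrightarrow> (1 / s) *\<^sub>R f \<in> D" by blast
      have "absorbs D ?B"
        unfolding absorbs_def
      proof (intro exI[of _ s] conjI allI impI subsetI)
        fix c f assume c: "s \<le> \<bar>c\<bar>" and f: "f \<in> ?B"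
        have "\<bar>s / c\<bar> \<le> 1" using c s by (simp add: abs_divide)
        then have "(s / c) *\<^sub>R ((1 / s) *\<^sub>R f) \<in> D" using bal sub[OF f] by blast
        then have "(1 / c) *\<^sub>R f \<in> D" using s by simp
        moreover have "f = c *\<^sub>R ((1 / c) *\<^sub>R f)" using c s by auto
        ultimately show "f \<in> (\<lambda>x. c *\<^sub>R x) ` D" by (metis image_eqI)
      qed (use s in auto)
      then show False using na by blast
    qed
    \<comment> \<open>If the ball of radius \<open>r / 2\<close> about \<open>f0\<close> lay in
      \<open>n D\<close>, then so would \<open>f0 + (r / 2) b\<close> and
      \<open>f0 - (r / 2) b\<close>. Half their difference would put \<open>(r / 2) b\<close> in
      \<open>n D\<close>, against the choice of \<open>b\<close>.\<close>
    have avoid: "\<exists>f\<in>topspace (Cp X). (\<forall>x. \<bar>f x - f0 x\<bar> \<le> r / 2) \<and> (1 / n) *\<^sub>R f \<notin> D"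
      if f0: "f0 \<in> topspace (Cp X)" and r: "r > 0" and n: "n > 0" for f0 and r n :: real
    proof (rule ccontr)
      assume none: "\<not> ?thesis"
      obtain b where b: "b \<in> ?B" "(1 / (2 * n / r)) *\<^sub>R b \<notin> D"
        using big[of "2 * n / r"] r n by auto
      have mem: "(1 / n) *\<^sub>R (\<lambda>x. f0 x + t * b x) \<in> D" if t: "\<bar>t\<bar> = r / 2" for t
      proof -
        have "\<bar>t * b x\<bar> \<le> r / 2" for x
          using b(1) r mult_left_mono[of "\<bar>b x\<bar>" 1 "r / 2"] by (simp add: abs_mult t)
        moreover have "(\<lambda>x. f0 x + t * b x) \<in> topspace (Cp X)"
          using b(1) by (intro Cp_add Cp_cmult f0) auto
        ultimately show ?thesis using none by fastforce
      qed
      have "(- 1) *\<^sub>R ((1 / n) *\<^sub>R (\<lambda>x. f0 x + (- (r / 2)) * b x)) \<in> D"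
        using r by (intro bal mem) auto
      then have "(1 / 2) *\<^sub>R ((1 / n) *\<^sub>R (\<lambda>x. f0 x + (r / 2) * b x)) +
          (1 / 2) *\<^sub>R ((- 1) *\<^sub>R ((1 / n) *\<^sub>R (\<lambda>x. f0 x + (- (r / 2)) * b x))) \<in> D"
        using r by (intro convexD[OF conv] mem) auto
      moreover have "(1 / 2) *\<^sub>R ((1 / n) *\<^sub>R (\<lambda>x. f0 x + (r / 2) * b x)) +
          (1 / 2) *\<^sub>R ((- 1) *\<^sub>R ((1 / n) *\<^sub>R (\<lambda>x. f0 x + (- (r / 2)) * b x))) = (1 / (2 * n / r)) *\<^sub>R b"
        using r n by (simp add: fun_eq_iff field_simps)
      ultimately show False using b(2) by simp
    qed
    \<comment> \<open>\<open>D\<close> is closed pointwise, and sup-norm balls are contained in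
      pointwise neighbourhoods once the radius is small.\<close>
    have robust: "\<exists>e>0. \<forall>g\<in>topspace (Cp X). (\<forall>x. \<bar>g x - f x\<bar> \<le> e) \<longrightarrow> (1 / n) *\<^sub>R g \<notin> D"
      if f: "f \<in> topspace (Cp X)" "(1 / n) *\<^sub>R f \<notin> D" and n: "n > 0" for f and n :: real
    proof -
      have op: "openin (pointwise_topology (topspace (Cp X))) (topspace (Cp X) - D)"
        using closed unfolding Cp_pointwise[symmetric] by (rule openin_diff[OF openin_topspace])
      have "(1 / n) *\<^sub>R f \<in> topspace (Cp X) - D" using f by (auto intro: subspace_scale[OF subspace_Cp])
      then obtain F d where d: "d > 0"
        and Fd: "\<And>g. g \<in> topspace (Cp X) \<Longrightarrow> (\<forall>x\<in>F. \<bar>g x - ((1 / n) *\<^sub>R f) x\<bar> < d) \<Longrightarrow> g \<in> topspace (Cp X) - D"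
        using pointwise_topology_nhd[OF op] by meson
      show ?thesis
      proof (intro exI[of _ "n * d / 2"] conjI ballI impI)
        fix g assume g: "g \<in> topspace (Cp X)" "\<forall>x. \<bar>g x - f x\<bar> \<le> n * d / 2"
        have "\<bar>((1 / n) *\<^sub>R g) x - ((1 / n) *\<^sub>R f) x\<bar> < d" for x
        proof -
          have "\<bar>((1 / n) *\<^sub>R g) x - ((1 / n) *\<^sub>R f) x\<bar> = \<bar>g x - f x\<bar> / n"
            using n by (simp flip: diff_divide_distrib)
          also have "\<dots> \<le> (n * d / 2) / n" using g(2) n by (intro divide_right_mono) auto
          also have "\<dots> < d" using n d by simp
          finally show ?thesis .
        qed
        then show "(1 / n) *\<^sub>R g \<notin> D"
          using Fd[of "(1 / n) *\<^sub>R g"] g(1) by (auto intro: subspace_scale[OF subspace_Cp])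
      qed (use n d in auto)
    qed
    define P where "P = (\<lambda>s::('a \<Rightarrow> real) \<times> real. fst s \<in> topspace (Cp X) \<and> 0 < snd s)"
    \<comment> \<open>A state is the centre and radius of a closed ball. Moving the centre by at
      most half the radius and at least halving the radius nests the balls, and the new ball misses
      \<open>(k + 1) D\<close>.\<close>
    define Q where "Q = (\<lambda>(k::nat) s s'. snd s' \<le> snd s / 2 \<and> (\<forall>x. \<bar>fst s' x - fst s x\<bar> \<le> snd s / 2) \<and>
      (\<forall>g\<in>topspace (Cp X). (\<forall>x. \<bar>g x - fst s' x\<bar> \<le> snd s') \<longrightarrow> (1 / real (Suc k)) *\<^sub>R g \<notin> D))"
    have "\<exists>s. \<forall>k. (P (s k) \<and> (k = 0 \<longrightarrow> snd (s k) = 1)) \<and> Q k (s k) (s (Suc k))"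
    proof (rule dependent_nat_choice)
      show "\<exists>s. P s \<and> ((0::nat) = 0 \<longrightarrow> snd s = 1)"
        unfolding P_def by (rule exI[of _ "(\<lambda>x. 0, 1)"]) (simp add: Cp_zero)
      fix s and k :: nat assume s: "P s \<and> (k = 0 \<longrightarrow> snd s = 1)"
      obtain f where f: "f \<in> topspace (Cp X)" "\<forall>x. \<bar>f x - fst s x\<bar> \<le> snd s / 2"
        "(1 / real (Suc k)) *\<^sub>R f \<notin> D"
        using avoid[of "fst s" "snd s" "real (Suc k)"] s unfolding P_def by auto
      obtain e where e: "e > 0"
        "\<forall>g\<in>topspace (Cp X). (\<forall>x. \<bar>g x - f x\<bar> \<le> e) \<longrightarrow> (1 / real (Suc k)) *\<^sub>R g \<notin> D"
        using robust[OF f(1,3)] by auto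
      have "P (f, min e (snd s / 2)) \<and> Q k s (f, min e (snd s / 2))"
        using s f e unfolding P_def Q_def by simp
      then show "\<exists>s'. (P s' \<and> (Suc k = 0 \<longrightarrow> snd s' = 1)) \<and> Q k s s'" by blast
    qed
    then obtain s where s: "\<And>k. P (s k)" "snd (s 0) = 1" "\<And>k. Q k (s k) (s (Suc k))" by blast
    define F where "F k = fst (s k)" for k
    define r where "r k = snd (s k)" for k
    have F: "F k \<in> topspace (Cp X)" and r_pos: "0 < r k" for k
      using s(1) by (auto simp: P_def F_def r_def)
    have r_half: "r (Suc k) \<le> r k / 2" and F_step: "\<bar>F (Suc k) x - F k x\<bar> \<le> r k / 2" for k x
      using s(3)[of k] by (auto simp: Q_def F_def r_def)
    have out: "(1 / real (Suc k)) *\<^sub>R g \<notin> D"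
      if "g \<in> topspace (Cp X)" "\<And>x. \<bar>g x - F (Suc k) x\<bar> \<le> r (Suc k)" for k g
      using s(3)[of k] that unfolding Q_def F_def r_def by blast
    have r_le: "r k \<le> (1 / 2) ^ k" for k
    proof (induction k)
      case 0 then show ?case using s(2) by (simp add: r_def)
    next
      case (Suc k) then show ?case using r_half[of k] by simp
    qed
    have r_lim: "r \<longlonglongrightarrow> 0"
    proof (rule tendsto_sandwich[of "\<lambda>_. 0" _ _ "\<lambda>k. (1 / 2) ^ k"])
      show "(\<lambda>k. (1 / 2 :: real) ^ k) \<longlonglongrightarrow> 0" by (rule LIMSEQ_power_zero) simp
    qed (use r_pos r_le in \<open>auto simp: less_imp_le\<close>)
    \<comment> \<open>The steps telescope, because \<open>r j / 2\<close> is at most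
      \<open>r j - r (Suc j)\<close>.\<close>
    have F_diff: "\<bar>F j x - F k x\<bar> \<le> r k - r j" if "k \<le> j" for j k x
      using that
    proof (induction j rule: dec_induct)
      case (step j)
      then show ?case using F_step[of j x] r_half[of j] by linarith
    qed simp
    have "Cauchy (\<lambda>k. F k x)" for x
    proof (rule metric_CauchyI)
      fix e :: real assume "0 < e"
      then obtain N where N: "r N < e / 2"
        using order_tendstoD(2)[OF r_lim, of "e / 2"] by (auto simp: eventually_sequentially)
      have "\<bar>F m x - F N x\<bar> < e / 2" if "m \<ge> N" for m
        using F_diff[OF that, of x] N r_pos[of m] by linarith
      then have "dist (F m x) (F n x) < e" if "m \<ge> N" "n \<ge> N" for m n
        using that dist_triangle_half_l[of "F m x" "F N x" e "F n x"] by (simp add: dist_real_def)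
      then show "\<exists>M. \<forall>m\<ge>M. \<forall>n\<ge>M. dist (F m x) (F n x) < e" by blast
    qed
    then have "\<forall>x. \<exists>l. (\<lambda>k. F k x) \<longlonglongrightarrow> l" by (simp add: Cauchy_convergent_iff convergent_def)
    then obtain g where g: "\<And>x. (\<lambda>k. F k x) \<longlonglongrightarrow> g x" by metis
    have gF: "\<bar>g x - F k x\<bar> \<le> r k" for x k
    proof (rule tendsto_upperbound)
      show "(\<lambda>j. \<bar>F j x - F k x\<bar>) \<longlonglongrightarrow> \<bar>g x - F k x\<bar>" by (intro tendsto_intros g)
      show "\<forall>\<^sub>F j in sequentially. \<bar>F j x - F k x\<bar> \<le> r k"
        using eventually_ge_at_top[of k]
      proof eventually_elim
        case (elim j)
        then show ?case using F_diff[of k j x] r_pos[of j] by simp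
      qed
    qed simp
    have "g \<in> topspace (Cp X)"
    proof (rule uniform_limit_Cp[OF F])
      fix e :: real assume "e > 0"
      then have "\<forall>\<^sub>F k in sequentially. r k < e" by (rule order_tendstoD(2)[OF r_lim])
      then show "\<forall>\<^sub>F k in sequentially. \<forall>x. \<bar>F k x - g x\<bar> < e"
        by eventually_elim (metis abs_minus_commute gF le_less_trans)
    qed
    then have notin: "(1 / real (Suc k)) *\<^sub>R g \<notin> D" for k by (rule out[OF _ gF])
    obtain q where q: "q > 0" "\<And>c. q \<le> \<bar>c\<bar> \<Longrightarrow> {g} \<subseteq> (\<lambda>x. c *\<^sub>R x) ` D"
      using absD[OF \<open>g \<in> topspace (Cp X)\<close>] unfolding absorbs_def by blast
    \<comment> \<open>Absorption of the single function \<open>g\<close> puts it in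
      \<open>(k + 1) D\<close>, which its ball was built to miss.\<close>
    obtain k :: nat where "q \<le> real k" using real_arch_simple by blast
    then obtain d where "d \<in> D" "g = real (Suc k) *\<^sub>R d" using q(2)[of "real (Suc k)"] by auto
    then show False using notin[of k] by simp
  qed
qed

text \<open>The case distinction supplies the zero values off the space that \<open>top_dual\<close>
  demands.\<close>

lemma evaluation_in_top_dual:
  assumes "finite A"
  shows "(\<lambda>f. if f \<in> topspace (Cp X) then evaluation A c f else 0) \<in> top_dual (Cp X)" (is "?\<phi> \<in> _")
proof -
  have ev: "linear_map_on (topspace (Cp X)) (evaluation A c)"
    "continuous_map (Cp X) euclideanreal (evaluation A c)"
    using continuous_functional_evaluation[OF assms, of X c] by (auto simp: continuous_functional_def)
  have "linear_map_on (topspace (Cp X)) ?\<phi>"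
    unfolding linear_map_on_def
  proof (intro conjI ballI allI)
    show "?\<phi> (f + g) = ?\<phi> f + ?\<phi> g" if "f \<in> topspace (Cp X)" "g \<in> topspace (Cp X)" for f g
      using that ev(1) subspace_add[OF subspace_Cp that] by (simp add: linear_map_on_def)
    show "?\<phi> (r *\<^sub>R f) = r *\<^sub>R ?\<phi> f" if "f \<in> topspace (Cp X)" for r f
      using that ev(1) subspace_scale[OF subspace_Cp that] by (simp add: linear_map_on_def)
  qed
  moreover have "continuous_map (Cp X) euclideanreal ?\<phi>"
    by (rule continuous_map_eq[OF ev(2)]) simp
  ultimately show ?thesis by (simp add: top_dual_def)
qed

text \<open>Convergence at every function is weak-star convergence, whereas each measure attains its
  total variation 1 on the barrel-bounded unit ball.\<close>

lemma JN_sequence_imp_josefson_nissenzweig: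
  assumes X: "tychonoff_space X" and JN: "JN_sequence X A c"
  shows "josefson_nissenzweig (Cp X)"
  unfolding josefson_nissenzweig_def
proof
  assume sc: "seq_continuous_map (weak_star_topology (Cp X)) (beta_star_topology (Cp X)) id"
  have A: "finite (A n)" "A n \<subseteq> topspace X" "(\<Sum>x\<in>A n. \<bar>c n x\<bar>) = 1" for n
    using JN by (auto simp: JN_sequence_def)
  have null: "(\<lambda>n. evaluation (A n) (c n) f) \<longlonglongrightarrow> 0" if "f \<in> topspace (Cp X)" for f
    using JN that by (auto simp: JN_sequence_def)
  define \<phi> where "\<phi> n f = (if f \<in> topspace (Cp X) then evaluation (A n) (c n) f else 0)" for n f
  have \<phi>: "\<phi> n \<in> top_dual (Cp X)" for n
    unfolding \<phi>_def by (rule evaluation_in_top_dual[OF A(1)])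
  have zero: "(\<lambda>_. 0) \<in> top_dual (Cp X)"
    by (simp add: top_dual_def linear_map_on_def)
  have "(\<lambda>n. \<phi> n f) \<longlonglongrightarrow> 0" for f
    using null[of f] by (cases "f \<in> topspace (Cp X)") (simp_all add: \<phi>_def)
  then have "limitin (weak_star_topology (Cp X)) \<phi> (\<lambda>_. 0) sequentially"
    unfolding weak_star_topology_def limitin_pointwise using \<phi> zero by simp
  moreover have "range \<phi> \<subseteq> topspace (weak_star_topology (Cp X))"
    using \<phi> by (auto simp: weak_star_topology_def)
  ultimately have lim: "limitin (beta_star_topology (Cp X)) \<phi> (\<lambda>_. 0) sequentially"
    using sc unfolding seq_continuous_map_def by (metis (no_types, lifting) id_apply limitin_sequentially)
  let ?B = "{f \<in> topspace (Cp X). \<forall>x. \<bar>f x\<bar> \<le> 1}"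
  \<comment> \<open>These functionals have norm below 1 on \<open>?B\<close>. Asking for a bound
    \<open>\<delta>\<close> strictly below 1 leaves the room that makes \<open>U\<close>
    open.\<close>
  define U where "U = {\<psi> \<in> top_dual (Cp X). \<exists>\<delta><1. \<forall>f\<in>?B. \<bar>\<psi> f\<bar> \<le> \<delta>}"
  have "openin (beta_star_topology (Cp X)) U"
    unfolding openin_beta_star beta_star_open_def
  proof (intro conjI ballI)
    show "U \<subseteq> top_dual (Cp X)" by (auto simp: U_def)
    fix \<psi> assume "\<psi> \<in> U"
    then obtain \<delta> where \<delta>: "\<delta> < 1" "\<forall>f\<in>?B. \<bar>\<psi> f\<bar> \<le> \<delta>" by (auto simp: U_def)
    have "{\<theta> \<in> top_dual (Cp X). \<forall>f\<in>?B. \<bar>\<theta> f - \<psi> f\<bar> < (1 - \<delta>) / 2} \<subseteq> U"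
    proof
      fix \<theta> assume \<theta>: "\<theta> \<in> {\<theta> \<in> top_dual (Cp X). \<forall>f\<in>?B. \<bar>\<theta> f - \<psi> f\<bar> < (1 - \<delta>) / 2}"
      have "\<bar>\<theta> f\<bar> \<le> (1 + \<delta>) / 2" if "f \<in> ?B" for f
      proof -
        have "\<bar>\<psi> f\<bar> \<le> \<delta>" "\<bar>\<theta> f - \<psi> f\<bar> < (1 - \<delta>) / 2" using \<delta> \<theta> that by blast+
        then show ?thesis using abs_triangle_ineq[of "\<theta> f - \<psi> f" "\<psi> f"] by (simp add: field_simps)
      qed
      moreover have "(1 + \<delta>) / 2 < 1" using \<delta> by simp
      ultimately show "\<theta> \<in> U" using \<theta> unfolding U_def by blast
    qed
    then show "\<exists>B \<epsilon>. barrel_bounded (Cp X) B \<and> \<epsilon> > 0 \<and>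
        {\<theta> \<in> top_dual (Cp X). \<forall>f\<in>B. \<bar>\<theta> f - \<psi> f\<bar> < \<epsilon>} \<subseteq> U"
      using \<delta>(1) by (intro exI[of _ ?B] exI[of _ "(1 - \<delta>) / 2"] conjI unit_ball_barrel_bounded) auto
  qed
  moreover have "(\<lambda>_. 0) \<in> U" using zero by (auto simp: U_def intro: exI[of _ 0])
  ultimately obtain n where "\<phi> n \<in> U"
    using lim unfolding limitin_def by (metis eventually_happens trivial_limit_sequentially)
  then obtain \<delta> where \<delta>: "\<delta> < 1" "\<And>f. f \<in> ?B \<Longrightarrow> \<bar>\<phi> n f\<bar> \<le> \<delta>" by (auto simp: U_def)
  \<comment> \<open>Taking the signs of the coefficients as values on the support recovers the full
    variation.\<close>
  obtain f where f: "f \<in> topspace (Cp X)" "\<forall>x. \<bar>f x\<bar> \<le> 1" "\<forall>x\<in>A n. f x = sgn (c n x)"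
    using tychonoff_bounded_interpolation[OF X closedin_empty A(1)[of n] A(2), where s = "\<lambda>x. sgn (c n x)"]
    by (auto simp: abs_sgn_eq)
  have "\<phi> n f = (\<Sum>x\<in>A n. \<bar>c n x\<bar>)"
    unfolding \<phi>_def evaluation_def using f by (auto intro!: sum.cong simp: abs_sgn)
  then have "\<phi> n f = 1" using A(3) by (rule trans)
  moreover have "\<bar>\<phi> n f\<bar> \<le> \<delta>" using \<delta>(2) f(1,2) by blast
  ultimately show False using \<delta>(1) by linarith
qed

section \<open>Quotients isomorphic to \<open>(c\<^sub>0)\<^sub>p\<close>\<close>

context
  notes sum.cong [fundef_cong]
begin

text \<open>This solves \<open>(I + M) y = a\<close>, where \<open>M\<close> is read strictly below
  the diagonal. The local congruence rule lets the termination proof see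
  \<open>j < k\<close>.\<close>

fun forward_subst :: "(nat \<Rightarrow> nat \<Rightarrow> real) \<Rightarrow> (nat \<Rightarrow> real) \<Rightarrow> nat \<Rightarrow> real" where
  "forward_subst M a k = a k - (\<Sum>j<k. M k j * forward_subst M a j)"

end

declare forward_subst.simps [simp del]

lemma forward_subst_eqI:
  assumes "\<And>k. a k = y k + (\<Sum>j<k. M k j * y j)"
  shows "forward_subst M a k = y k"
proof (induction k rule: less_induct)
  case (less k)
  have "forward_subst M a k = a k - (\<Sum>j<k. M k j * y j)"
    using less by (simp add: forward_subst.simps[of M a k])
  then show ?case using assms[of k] by simp
qed

text \<open>Row sums of at most 1/2 keep the solution bounded. An eventual bound \<open>L\<close>
  then improves to \<open>3 / 4 * L\<close>: late entries contribute at most \<open>L / 2\<close>,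
  while \<open>a\<close> and the finitely many early columns together fall below
  \<open>L / 4\<close>. Iteration drives the bound to zero.\<close>

lemma forward_subst_tendsto_zero:
  assumes a: "a \<longlonglongrightarrow> 0" and row: "\<And>k. (\<Sum>j<k. \<bar>M k j\<bar>) \<le> 1 / 2"
    and col: "\<And>j. (\<lambda>k. M k j) \<longlonglongrightarrow> 0"
  shows "forward_subst M a \<longlonglongrightarrow> 0"
proof -
  let ?v = "forward_subst M a"
  obtain K where K: "K > 0" "\<And>k. \<bar>a k\<bar> \<le> K"
    using convergent_imp_Bseq[OF convergentI[OF a]] by (auto simp: Bseq_def)
  have step: "\<bar>?v k\<bar> \<le> \<bar>a k\<bar> + (\<Sum>j<k. \<bar>M k j\<bar> * \<bar>?v j\<bar>)" for k
  proof -
    have "\<bar>?v k\<bar> \<le> \<bar>a k\<bar> + \<bar>\<Sum>j<k. M k j * ?v j\<bar>"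
      by (subst forward_subst.simps) (rule abs_triangle_ineq4)
    also have "\<bar>\<Sum>j<k. M k j * ?v j\<bar> \<le> (\<Sum>j<k. \<bar>M k j * ?v j\<bar>)" by (rule sum_abs)
    finally show ?thesis by (simp add: abs_mult)
  qed
  have tail: "(\<Sum>j\<in>J. \<bar>M k j\<bar> * \<bar>?v j\<bar>) \<le> L / 2"
    if J: "J \<subseteq> {..<k}" "\<And>j. j \<in> J \<Longrightarrow> \<bar>?v j\<bar> \<le> L" "L \<ge> 0" for J k L
  proof -
    have "(\<Sum>j\<in>J. \<bar>M k j\<bar> * \<bar>?v j\<bar>) \<le> (\<Sum>j\<in>J. \<bar>M k j\<bar> * L)"
      using J(2) by (intro sum_mono mult_left_mono) auto
    also have "\<dots> = (\<Sum>j\<in>J. \<bar>M k j\<bar>) * L" by (simp add: sum_distrib_right)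
    also have "\<dots> \<le> (\<Sum>j<k. \<bar>M k j\<bar>) * L"
      using J by (intro mult_right_mono sum_mono2) auto
    also have "\<dots> \<le> 1 / 2 * L" using row J(3) by (intro mult_right_mono) auto
    finally show ?thesis by simp
  qed
  \<comment> \<open>The bound reproduces itself, since
    \<open>K + (2 * K) / 2 = 2 * K\<close>.\<close>
  have bdd: "\<bar>?v k\<bar> \<le> 2 * K" for k
  proof (induction k rule: less_induct)
    case (less k)
    have "(\<Sum>j<k. \<bar>M k j\<bar> * \<bar>?v j\<bar>) \<le> (2 * K) / 2"
      using less K(1) by (intro tail) auto
    then show ?case using step[of k] K(2)[of k] by linarith
  qed
  have ev: "\<forall>\<^sub>F k in sequentially. \<bar>?v k\<bar> \<le> 2 * K * (3 / 4) ^ i" for i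
  proof (induction i)
    case 0
    then show ?case using bdd by simp
  next
    case (Suc i)
    define L where "L = 2 * K * (3 / 4) ^ i"
    have L: "L > 0" using K by (simp add: L_def)
    obtain N where N: "\<And>k. k \<ge> N \<Longrightarrow> \<bar>?v k\<bar> \<le> L"
      using Suc unfolding L_def eventually_sequentially by blast
    have "(\<lambda>k. \<bar>a k\<bar> + (\<Sum>j<N. \<bar>M k j\<bar> * \<bar>?v j\<bar>)) \<longlonglongrightarrow> \<bar>0\<bar> + (\<Sum>j<N. \<bar>0\<bar> * \<bar>?v j\<bar>)"
      by (intro tendsto_intros a col)
    then have "\<forall>\<^sub>F k in sequentially. \<bar>a k\<bar> + (\<Sum>j<N. \<bar>M k j\<bar> * \<bar>?v j\<bar>) < L / 4"
      using L by (intro order_tendstoD(2)) auto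
    then show ?case using eventually_ge_at_top[of N]
    proof eventually_elim
      case (elim k)
      have "(\<Sum>j<k. \<bar>M k j\<bar> * \<bar>?v j\<bar>)
          = (\<Sum>j<N. \<bar>M k j\<bar> * \<bar>?v j\<bar>) + (\<Sum>j=N..<k. \<bar>M k j\<bar> * \<bar>?v j\<bar>)"
        using elim(2) by (subst sum.union_disjoint[symmetric]) (auto intro!: sum.cong)
      moreover have "(\<Sum>j=N..<k. \<bar>M k j\<bar> * \<bar>?v j\<bar>) \<le> L / 2"
        using N L by (intro tail) auto
      moreover have "2 * K * (3 / 4) ^ Suc i = 3 / 4 * L" by (simp add: L_def)
      ultimately show ?case using step[of k] elim(1) by linarith
    qed
  qed
  show ?thesis
  proof (rule LIMSEQ_I)
    fix e :: real assume e: "0 < e"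
    have "(\<lambda>i. 2 * K * (3 / 4) ^ i) \<longlonglongrightarrow> 2 * K * 0"
      by (intro tendsto_intros LIMSEQ_power_zero) simp
    then have "\<forall>\<^sub>F i in sequentially. 2 * K * (3 / 4) ^ i < e"
      using e by (intro order_tendstoD(2)) auto
    then obtain i where i: "2 * K * (3 / 4) ^ i < e"
      using eventually_happens'[OF sequentially_bot] by blast
    obtain N where "\<And>k. k \<ge> N \<Longrightarrow> \<bar>?v k\<bar> \<le> 2 * K * (3 / 4) ^ i"
      using ev[of i] unfolding eventually_sequentially by blast
    then show "\<exists>no. \<forall>n\<ge>no. norm (?v n - 0) < e" using i by (intro exI[of _ N]) force
  qed
qed

text \<open>Each coordinate of the solution is a finite linear combination of \<open>L 0\<close> up
  to \<open>L k\<close>.\<close>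

lemma continuous_functional_forward_subst:
  assumes L: "\<And>k. continuous_functional X (L k)"
  shows "continuous_functional X (\<lambda>f. forward_subst M (\<lambda>i. L i f) k)"
proof (induction k rule: less_induct)
  case (less k)
  have IH: "linear_map_on (topspace (Cp X)) (\<lambda>f. forward_subst M (\<lambda>i. L i f) j)"
    "continuous_map (Cp X) euclideanreal (\<lambda>f. forward_subst M (\<lambda>i. L i f) j)" if "j < k" for j
    using less[OF that] by (auto simp: continuous_functional_def)
  have Lk: "linear_map_on (topspace (Cp X)) (L k)" "continuous_map (Cp X) euclideanreal (L k)"
    using L[of k] by (auto simp: continuous_functional_def)
  have eq: "(\<lambda>f. forward_subst M (\<lambda>i. L i f) k) =
      (\<lambda>f. L k f - (\<Sum>j<k. M k j * forward_subst M (\<lambda>i. L i f) j))"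
    by (rule ext, subst forward_subst.simps) simp
  show ?case
    unfolding eq continuous_functional_def
  proof
    have add: "(\<Sum>j<k. M k j * forward_subst M (\<lambda>i. L i (f + g)) j) =
        (\<Sum>j<k. M k j * forward_subst M (\<lambda>i. L i f) j) + (\<Sum>j<k. M k j * forward_subst M (\<lambda>i. L i g) j)"
      if "f \<in> topspace (Cp X)" "g \<in> topspace (Cp X)" for f g
      unfolding sum.distrib[symmetric]
      using IH(1) that by (intro sum.cong) (auto simp: linear_map_on_def distrib_left)
    have scale: "(\<Sum>j<k. M k j * forward_subst M (\<lambda>i. L i (r *\<^sub>R f)) j) =
        r * (\<Sum>j<k. M k j * forward_subst M (\<lambda>i. L i f) j)"
      if "f \<in> topspace (Cp X)" for f r
      unfolding sum_distrib_left
      using IH(1) that by (intro sum.cong) (auto simp: linear_map_on_def)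
    show "linear_map_on (topspace (Cp X)) (\<lambda>f. L k f - (\<Sum>j<k. M k j * forward_subst M (\<lambda>i. L i f) j))"
      using Lk(1) by (auto simp: linear_map_on_def add scale right_diff_distrib)
    show "continuous_map (Cp X) euclideanreal (\<lambda>f. L k f - (\<Sum>j<k. M k j * forward_subst M (\<lambda>i. L i f) j))"
      by (intro continuous_map_diff continuous_map_sum continuous_map_real_mult_left Lk IH) auto
  qed
qed

text \<open>
  Solving the triangular system turns \<open>L\<close> into a sequence biorthogonal to \<open>f\<close>, which defines the
  quotient map.  It has the continuous linear right inverse \<open>y \<mapsto> \<Sum>j. y j * f j\<close>, a sum with at most
  one nonzero term at each point.
\<close>

lemma triangular_system_gives_c0_quotient:
  fixes L :: "nat \<Rightarrow> ('a \<Rightarrow> real) \<Rightarrow> real"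
  assumes L: "\<And>k. continuous_functional X (L k)"
    and null: "\<And>g. g \<in> topspace (Cp X) \<Longrightarrow> (\<lambda>k. L k g) \<longlonglongrightarrow> 0"
    and f: "\<And>k. f k \<in> topspace (Cp X)" "\<And>k x. \<bar>f k x\<bar> \<le> 1"
    and disj: "\<And>j k x. j \<noteq> k \<Longrightarrow> f j x * f k x = 0"
    and upper: "\<And>j k. k < j \<Longrightarrow> L k (f j) = 0" and diag: "\<And>k. L k (f k) = 1"
    and lower: "\<And>k. (\<Sum>j<k. \<bar>L k (f j)\<bar>) \<le> 1 / 2"
  shows "has_quotient_isomorphic (Cp X) c0_p"
proof -
  define M where "M k j = L k (f j)" for k j
  define q where "q g k = forward_subst M (\<lambda>i. L i g) k" for g k
  define S where "S x = {j. f j x \<noteq> 0}" for x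
  \<comment> \<open>Disjointness leaves at most one index in \<open>S x\<close>, so the formal
    infinite sum is finite at every point.\<close>
  define R where "R y x = (\<Sum>j\<in>S x. y j * f j x)" for y x
  have Llin: "linear_map_on (topspace (Cp X)) (L k)" and Lcont: "continuous_map (Cp X) euclideanreal (L k)" for k
    using L[of k] by (auto simp: continuous_functional_def)
  have q_lin: "linear_map_on (topspace (Cp X)) (\<lambda>g. q g k)"
    and q_cont: "continuous_map (Cp X) euclideanreal (\<lambda>g. q g k)" for k
    using continuous_functional_forward_subst[OF L, where M = M and k = k] by (auto simp: continuous_functional_def q_def)
  have q_null: "q g \<longlonglongrightarrow> 0" if "g \<in> topspace (Cp X)" for g
    unfolding q_def
  proof (rule forward_subst_tendsto_zero)
    show "(\<lambda>i. L i g) \<longlonglongrightarrow> 0" by (rule null[OF that])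
    show "(\<Sum>j<k. \<bar>M k j\<bar>) \<le> 1 / 2" for k using lower by (simp add: M_def)
    show "(\<lambda>k. M k j) \<longlonglongrightarrow> 0" for j unfolding M_def by (rule null[OF f(1)])
  qed
  have S: "S x = {} \<or> (\<exists>j. S x = {j})" for x
  proof (cases "S x = {}")
    case False
    then obtain j where j: "j \<in> S x" by blast
    have "k = j" if "k \<in> S x" for k using disj[of k j x] that j by (auto simp: S_def)
    then show ?thesis using j by blast
  qed simp
  have finS: "finite (S x)" for x using S[of x] by auto
  have R_part: "(\<Sum>j<n. y j * f j x) = (\<Sum>j\<in>S x \<inter> {..<n}. y j * f j x)" for y n x
    by (rule sum.mono_neutral_right) (auto simp: S_def)
  \<comment> \<open>At each point a partial sum omits at most one term, of size at most a tail entry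
    of \<open>y\<close>. So the partial sums converge uniformly and \<open>R y\<close> is
    continuous.\<close>
  have R_close: "\<bar>(\<Sum>j<n. y j * f j x) - R y x\<bar> \<le> e" if "\<And>j. j \<ge> n \<Longrightarrow> \<bar>y j\<bar> \<le> e" for y n x e
  proof -
    have e: "0 \<le> e" using that[of n] by simp
    consider "S x = {}" | j where "S x = {j}" "j < n" | j where "S x = {j}" "n \<le> j"
      using S[of x] not_le by blast
    then show ?thesis
    proof cases
      case (3 j)
      have "\<bar>y j * f j x\<bar> \<le> e * 1"
        unfolding abs_mult using that[OF 3(2)] f(2) by (intro mult_mono) auto
      then show ?thesis using 3 by (simp add: R_part R_def)
    qed (use e in \<open>auto simp: R_part R_def\<close>)
  qed
  have part_in: "(\<lambda>x. \<Sum>j<n. y j * f j x) \<in> topspace (Cp X)" for y n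
    by (intro Cp_sum Cp_cmult f) simp
  have R_in: "R y \<in> topspace (Cp X)" if y: "y \<longlonglongrightarrow> 0" for y
  proof (rule uniform_limit_Cp[OF part_in])
    fix e :: real assume e: "e > 0"
    obtain N where N: "\<And>j. j \<ge> N \<Longrightarrow> norm (y j - 0) < e / 2"
      using LIMSEQ_D[OF y, of "e / 2"] e by auto
    have "\<bar>(\<Sum>j<n. y j * f j x) - R y x\<bar> < e" if "n \<ge> N" for n x
    proof -
      have "\<bar>(\<Sum>j<n. y j * f j x) - R y x\<bar> \<le> e / 2"
        using N that by (intro R_close) (force intro: less_imp_le)
      then show ?thesis using e by simp
    qed
    then show "\<forall>\<^sub>F n in sequentially. \<forall>x. \<bar>(\<Sum>j<n. y j * f j x) - R y x\<bar> < e"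
      unfolding eventually_sequentially by blast
  qed
  \<comment> \<open>The partial sums converge pointwise and \<open>L k\<close> is continuous for
    that convergence. Their images are constant from \<open>n = Suc k\<close> on, since the entries
    above the diagonal vanish.\<close>
  have L_R: "L k (R y) = y k + (\<Sum>j<k. M k j * y j)" if y: "y \<longlonglongrightarrow> 0" for y k
  proof -
    have "limitin (Cp X) (\<lambda>n x. \<Sum>j<n. y j * f j x) (R y) sequentially"
      unfolding limitin_Cp
    proof (intro conjI allI)
      fix x
      have "\<forall>\<^sub>F n in sequentially. (\<Sum>j<n. y j * f j x) = R y x"
      proof -
        obtain N where N: "S x \<subseteq> {..<N}" using finite_nat_iff_bounded[THEN iffD1, OF finS] by blast
        have "(\<Sum>j<n. y j * f j x) = R y x" if "n \<ge> N" for n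
        proof -
          have "S x \<inter> {..<n} = S x" using N that by auto
          then show ?thesis by (simp add: R_part R_def)
        qed
        then show ?thesis unfolding eventually_sequentially by blast
      qed
      then show "(\<lambda>n. \<Sum>j<n. y j * f j x) \<longlonglongrightarrow> R y x" by (rule tendsto_eventually)
    qed (use part_in R_in[OF y] in auto)
    then have "(\<lambda>n. L k (\<lambda>x. \<Sum>j<n. y j * f j x)) \<longlonglongrightarrow> L k (R y)"
      using continuous_map_limit[OF Lcont[of k]] by (simp add: comp_def)
    moreover have "\<forall>\<^sub>F n in sequentially. L k (\<lambda>x. \<Sum>j<n. y j * f j x) = y k + (\<Sum>j<k. M k j * y j)"
      using eventually_ge_at_top[of "Suc k"]
    proof eventually_elim
      case (elim n)
      have "L k (\<lambda>x. \<Sum>j<n. y j * f j x) = (\<Sum>j<n. y j * L k (f j))"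
        using linear_map_on_sum[OF Llin, of "{..<n}" f k y] f(1) by simp
      also have "\<dots> = (\<Sum>j<Suc k. y j * L k (f j))"
        using elim upper by (intro sum.mono_neutral_right) auto
      also have "\<dots> = y k + (\<Sum>j<k. M k j * y j)"
        using diag by (simp add: M_def mult.commute)
      finally show ?case .
    qed
    then have "(\<lambda>n. L k (\<lambda>x. \<Sum>j<n. y j * f j x)) \<longlonglongrightarrow> y k + (\<Sum>j<k. M k j * y j)"
      by (rule tendsto_eventually)
    ultimately show ?thesis by (rule LIMSEQ_unique)
  qed
  have q_R: "q (R y) = y" if "y \<longlonglongrightarrow> 0" for y
    unfolding q_def using forward_subst_eqI[OF L_R[OF that]] by blast
  have cls: "continuous_linear_surjection (Cp X) c0_p q"
    unfolding continuous_linear_surjection_def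
  proof (intro conjI)
    show "linear_map_on (topspace (Cp X)) q"
      using q_lin by (auto simp: linear_map_on_def fun_eq_iff)
    show "continuous_map (Cp X) c0_p q"
      unfolding c0_p_def continuous_map_into_pointwise using q_null q_cont by auto
    show "q ` topspace (Cp X) = topspace c0_p"
      unfolding c0_p_def topspace_pointwise
    proof (intro equalityI subsetI)
      fix y assume "y \<in> {x :: nat \<Rightarrow> real. x \<longlonglongrightarrow> 0}"
      then have y: "y \<longlonglongrightarrow> 0" by simp
      show "y \<in> q ` topspace (Cp X)"
        by (rule image_eqI[where x = "R y"]) (simp_all only: q_R[OF y] R_in[OF y])
    qed (use q_null in auto)
  qed
  have "open_map (Cp X) c0_p q"
    unfolding open_map_def
  proof (intro allI impI)
    fix U assume U: "openin (Cp X) U"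
    show "openin c0_p (q ` U)"
    proof (subst openin_subopen, intro ballI)
      fix z assume "z \<in> q ` U"
      then obtain u where u: "u \<in> U" "z = q u" by blast
      have uX: "u \<in> topspace (Cp X)" using openin_subset[OF U] u(1) by blast
      have z: "z \<longlonglongrightarrow> 0" using q_null[OF uX] u(2) by simp
      let ?G = "\<lambda>y x. u x + R (\<lambda>i. y i - z i) x"
      have yz: "(\<lambda>i. y i - z i) \<longlonglongrightarrow> 0" if "y \<longlonglongrightarrow> 0" for y
        using tendsto_diff[OF that z] by simp
      have G_in: "?G y \<in> topspace (Cp X)" if "y \<longlonglongrightarrow> 0" for y
        by (intro Cp_add uX R_in yz that)
      have "continuous_map c0_p (Cp X) ?G"
        unfolding continuous_map_into_Cp
      proof (intro conjI ballI allI)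
        show "?G y \<in> topspace (Cp X)" if "y \<in> topspace c0_p" for y
          using that G_in by (simp add: c0_p_def)
        show "continuous_map c0_p euclideanreal (\<lambda>y. ?G y x)" for x
          unfolding R_def c0_p_def
          by (intro continuous_map_add continuous_map_sum continuous_map_real_mult_right
              continuous_map_diff continuous_map_coordinate finS) auto
      qed
      then have "openin c0_p {y \<in> topspace c0_p. ?G y \<in> U}"
        by (rule openin_continuous_map_preimage[OF _ U])
      moreover have "z \<in> {y \<in> topspace c0_p. ?G y \<in> U}"
        using z u(1) by (simp add: c0_p_def R_def)
      moreover have "{y \<in> topspace c0_p. ?G y \<in> U} \<subseteq> q ` U"
      proof
        fix y assume "y \<in> {y \<in> topspace c0_p. ?G y \<in> U}"
        then have y: "y \<longlonglongrightarrow> 0" "?G y \<in> U" by (auto simp: c0_p_def)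
        have "q (?G y) i = y i" for i
          using linear_map_onD(1)[OF q_lin uX R_in[OF yz[OF y(1)]], of i] q_R[OF yz[OF y(1)]]
          by (simp add: u(2))
        then have "y = q (?G y)" by (simp add: fun_eq_iff)
        then show "y \<in> q ` U" using y(2) by blast
      qed
      ultimately show "\<exists>T. openin c0_p T \<and> z \<in> T \<and> T \<subseteq> q ` U" by blast
    qed
  qed
  then have "linear_quotient_map (Cp X) c0_p q" using cls by (simp add: linear_quotient_map_def)
  moreover have "linear_homeomorphism c0_p c0_p id"
    by (simp add: linear_homeomorphism_def linear_map_on_def)
  ultimately show ?thesis
    unfolding has_quotient_isomorphic_def using locally_convex_c0_p by blast
qed

section \<open>Extraction of functions with disjoint supports\<close>

definition variation :: "'a set \<Rightarrow> ('a \<Rightarrow> real) \<Rightarrow> 'a set \<Rightarrow> real" where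
  "variation A c W = (\<Sum>x\<in>A \<inter> W. \<bar>c x\<bar>)"

lemma variation_cover:
  assumes "finite A" "A \<inter> U \<subseteq> V \<union> W"
  shows "variation A c U \<le> variation A c V + variation A c W"
proof -
  have "variation A c U \<le> (\<Sum>x\<in>(A \<inter> V) \<union> (A \<inter> W). \<bar>c x\<bar>)"
    unfolding variation_def using assms by (intro sum_mono2) auto
  also have "\<dots> \<le> variation A c V + variation A c W"
    unfolding variation_def using assms by (subst sum_Un) (auto intro: sum_nonneg)
  finally show ?thesis .
qed

text \<open>If all \<open>m\<close> disjoint sets carried more than \<open>1 / m\<close>, the total
  mass would exceed 1.\<close>

lemma small_variation_on_disjoint_sets:
  assumes "finite A" "(\<Sum>x\<in>A. \<bar>c x\<bar>) \<le> 1" "m > 0"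
    and disj: "\<And>i j x. i < m \<Longrightarrow> j < m \<Longrightarrow> x \<in> V i \<Longrightarrow> x \<in> V j \<Longrightarrow> i = j"
  shows "\<exists>i<m. variation A c (V i) \<le> 1 / real m"
proof (rule ccontr)
  assume "\<not> ?thesis"
  then have "(\<Sum>i<m. 1 / real m) < (\<Sum>i<m. variation A c (V i))"
    using assms(3) by (intro sum_strict_mono) (auto simp: not_le)
  also have "\<dots> = (\<Sum>x\<in>(\<Union>i<m. A \<inter> V i). \<bar>c x\<bar>)"
    unfolding variation_def using disj assms(1) by (subst sum.UNION_disjoint) blast+
  also have "\<dots> \<le> (\<Sum>x\<in>A. \<bar>c x\<bar>)"
    using assms(1) by (intro sum_mono2) auto
  finally show False using assms by simp
qed

text \<open>
  Testing against the finitely many sign patterns on \<open>F\<close> shows that the mass on \<open>F\<close> is eventually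
  at most the remaining mass plus \<open>1/3\<close>.
\<close>

lemma JN_sequence_mass_off_finite:
  assumes X: "tychonoff_space X" and JN: "JN_sequence X A c" and F: "finite F" "F \<subseteq> topspace X"
  shows "\<forall>\<^sub>F n in sequentially. 1 / 3 \<le> variation (A n) (c n) (- F)"
proof -
  have "\<exists>f\<in>topspace (Cp X). (\<forall>x. \<bar>f x\<bar> \<le> 1) \<and> (\<forall>b\<in>F. f b = (if b \<in> T then 1 else - 1))" for T
    using tychonoff_bounded_interpolation[OF X closedin_empty F, where s = "\<lambda>b. if b \<in> T then 1 else - 1"]
    by auto
  then obtain \<phi> where \<phi>: "\<And>T. \<phi> T \<in> topspace (Cp X)" "\<And>T x. \<bar>\<phi> T x\<bar> \<le> 1"
    "\<And>T b. b \<in> F \<Longrightarrow> \<phi> T b = (if b \<in> T then 1 else - 1)"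
    by metis
  have "\<forall>\<^sub>F n in sequentially. \<forall>T\<in>Pow F. \<bar>evaluation (A n) (c n) (\<phi> T)\<bar> < 1 / 3"
  proof (rule eventually_ball_finite)
    show "\<forall>T\<in>Pow F. \<forall>\<^sub>F n in sequentially. \<bar>evaluation (A n) (c n) (\<phi> T)\<bar> < 1 / 3"
    proof
      fix T
      have "(\<lambda>n. \<bar>evaluation (A n) (c n) (\<phi> T)\<bar>) \<longlonglongrightarrow> 0"
        using JN \<phi>(1) unfolding JN_sequence_def tendsto_rabs_zero_iff by blast
      then show "\<forall>\<^sub>F n in sequentially. \<bar>evaluation (A n) (c n) (\<phi> T)\<bar> < 1 / 3"
        by (rule order_tendstoD(2)) simp
    qed
  qed (use F in simp)
  then show ?thesis
  proof eventually_elim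
    case (elim n)
    have A: "finite (A n)" "(\<Sum>x\<in>A n. \<bar>c n x\<bar>) = 1" using JN by (auto simp: JN_sequence_def)
    \<comment> \<open>This pattern depends on \<open>n\<close> and turns the mass on
      \<open>F\<close> into an integral. The preceding bound covers it because it holds for all
      subsets of \<open>F\<close> at once.\<close>
    define T where "T = {x \<in> F. 0 \<le> c n x}"
    have e: "\<bar>evaluation (A n) (c n) (\<phi> T)\<bar> < 1 / 3" using elim by (auto simp: T_def)
    have "evaluation (A n) (c n) (\<phi> T)
        = (\<Sum>x\<in>A n \<inter> F. c n x * \<phi> T x) + evaluation (A n - F) (c n) (\<phi> T)"
      unfolding evaluation_def by (rule sum.Int_Diff[OF A(1)])
    also have "(\<Sum>x\<in>A n \<inter> F. c n x * \<phi> T x) = (\<Sum>x\<in>A n \<inter> F. \<bar>c n x\<bar>)"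
      by (intro sum.cong) (auto simp: \<phi>(3) T_def)
    finally have "(\<Sum>x\<in>A n \<inter> F. \<bar>c n x\<bar>) - (\<Sum>x\<in>A n - F. \<bar>c n x\<bar>) < 1 / 3"
      using e evaluation_le[of "A n - F" "\<phi> T" 1 "c n", OF \<phi>(2)] by linarith
    moreover have "(\<Sum>x\<in>A n \<inter> F. \<bar>c n x\<bar>) + (\<Sum>x\<in>A n - F. \<bar>c n x\<bar>) = 1"
      using sum.Int_Diff[OF A(1), of "\<lambda>x. \<bar>c n x\<bar>" F] A(2) by simp
    ultimately show ?case by (simp add: variation_def Diff_eq)
  qed
qed

lemma infinite_Collect_eventually:
  assumes "infinite (N :: nat set)" "\<forall>\<^sub>F n in sequentially. P n"
  shows "infinite {n \<in> N. P n}"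
proof
  assume fin: "finite {n \<in> N. P n}"
  obtain K where "\<And>n. n \<ge> K \<Longrightarrow> P n" using assms(2) by (auto simp: eventually_sequentially)
  then have "N \<subseteq> {n \<in> N. P n} \<union> {..<K}" by (auto simp: not_less)
  then show False using fin assms(1) by (meson finite_UnI finite_lessThan finite_subset)
qed

text \<open>
  Among \<open>m\<close> measures of the sequence with pairwise disjoint parts outside \<open>W \<union> F\<close>, separated by
  the level sets of one continuous function, at least one has a neighbourhood of its part which
  carries at most \<open>1/m\<close> of the mass of infinitely many later measures.
\<close>

lemma JN_sequence_extraction_step:
  assumes X: "tychonoff_space X" and JN: "JN_sequence X A c" and N: "infinite N"
    and W: "closedin X W" and F: "finite F" "F \<subseteq> topspace X"
    and \<beta>: "\<beta> \<le> 1 / 12" "\<And>n. n \<in> N \<Longrightarrow> variation (A n) (c n) W \<le> \<beta>" and \<delta>: "\<delta> > 0"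
  obtains n f V N' where "n \<in> N" "f \<in> topspace (Cp X)" "\<And>x. \<bar>f x\<bar> \<le> 1" "\<And>x. x \<in> W \<union> F \<Longrightarrow> f x = 0"
    "closedin X V" "W \<subseteq> V" "\<And>x. x \<notin> V \<Longrightarrow> f x = 0" "1 / 4 \<le> evaluation (A n) (c n) f"
    "N' \<subseteq> N" "infinite N'" "\<And>k. k \<in> N' \<Longrightarrow> n < k"
    "\<And>k. k \<in> N' \<Longrightarrow> variation (A k) (c k) V \<le> \<beta> + \<delta>"
    "\<And>k. k \<in> N' \<Longrightarrow> \<bar>evaluation (A k) (c k) f\<bar> \<le> \<delta>"
proof -
  have A: "finite (A n)" "A n \<subseteq> topspace X" "(\<Sum>x\<in>A n. \<bar>c n x\<bar>) = 1" for n
    using JN by (auto simp: JN_sequence_def)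
  have Wsub: "W \<subseteq> topspace X" by (rule closedin_subset[OF W])
  \<comment> \<open>Of the mass 1/3 outside \<open>G\<close>, at most 1/12 lies in \<open>W\<close>,
    and \<open>1 / 3 - 1 / 12 = 1 / 4\<close>.\<close>
  have "\<exists>n. n \<in> N \<and> 1 / 4 \<le> variation (A n) (c n) (- (W \<union> G))" if G: "finite G" "G \<subseteq> topspace X" for G
  proof -
    have "infinite {n \<in> N. 1 / 3 \<le> variation (A n) (c n) (- G)}"
      by (rule infinite_Collect_eventually[OF N JN_sequence_mass_off_finite[OF X JN G]])
    then obtain n where n: "n \<in> N" "1 / 3 \<le> variation (A n) (c n) (- G)"
      using not_finite_existsD by blast
    have "variation (A n) (c n) (- G) \<le> variation (A n) (c n) (- (W \<union> G)) + variation (A n) (c n) W"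
      by (rule variation_cover[OF A(1)]) auto
    then show ?thesis using n \<beta>(2)[OF n(1)] \<beta>(1) by (intro exI[of _ n]) linarith
  qed
  then obtain p where p: "\<And>G. finite G \<Longrightarrow> G \<subseteq> topspace X \<Longrightarrow> p G \<in> N"
    "\<And>G. finite G \<Longrightarrow> G \<subseteq> topspace X \<Longrightarrow> 1 / 4 \<le> variation (A (p G)) (c (p G)) (- (W \<union> G))"
    by metis
  \<comment> \<open>\<open>G i\<close> collects \<open>F\<close> and the supports of all measures
    chosen before, which makes the sets \<open>B i\<close> pairwise disjoint.\<close>
  define G where "G = rec_nat F (\<lambda>_ G. G \<union> A (p G))"
  have G_simps: "G 0 = F" "\<And>i. G (Suc i) = G i \<union> A (p (G i))" by (simp_all add: G_def)
  have G: "finite (G i) \<and> G i \<subseteq> topspace X" for i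
    by (induction i) (use F A in \<open>auto simp: G_simps\<close>)
  have G_mono: "G i \<subseteq> G j" if "i \<le> j" for i j
    by (rule lift_Suc_mono_le[OF _ that]) (auto simp: G_simps)
  define n where "n i = p (G i)" for i
  define B where "B i = A (n i) - (W \<union> G i)" for i
  have n: "n i \<in> N" "1 / 4 \<le> variation (A (n i)) (c (n i)) (- (W \<union> G i))" for i
    using p G by (auto simp: n_def)
  have B: "finite (B i)" "B i \<subseteq> topspace X" "B i \<inter> (W \<union> F) = {}" for i
    using A G_mono[of 0 i] by (auto simp: B_def G_simps)
  have B_disj: "i = j" if "x \<in> B i" "x \<in> B j" for i j x
  proof (rule ccontr)
    assume "i \<noteq> j"
    then consider "Suc i \<le> j" | "Suc j \<le> i" by linarith
    then show False
      using G_mono[of "Suc i" j] G_mono[of "Suc j" i] that by cases (auto simp: B_def n_def G_simps)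
  qed
  obtain m0 :: nat where "1 / \<delta> < real m0" using reals_Archimedean2 by blast
  define m where "m = Suc m0"
  have m: "m > 0" "1 / real m \<le> \<delta>"
  proof -
    have "1 / \<delta> \<le> real m" using \<open>1 / \<delta> < real m0\<close> by (simp add: m_def)
    then show "1 / real m \<le> \<delta>" using \<delta> by (simp add: m_def field_simps)
  qed (simp add: m_def)
  have "closedin X (W \<union> F)" by (intro closedin_Un W tychonoff_finite_closed[OF X] F)
  moreover have UB: "finite (\<Union>i<m. B i)" "(\<Union>i<m. B i) \<subseteq> topspace X" "(\<Union>i<m. B i) \<inter> (W \<union> F) = {}"
    using B(1,2) B(3)[THEN equalityD1] by blast+
  \<comment> \<open>One function marks every \<open>B i\<close> by the level \<open>Suc i\<close>.
    Starting at 1 keeps these levels away from the value 0 on \<open>W \<union> F\<close>.\<close>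
  ultimately obtain h where h: "h \<in> topspace (Cp X)"
    "\<forall>b\<in>(\<Union>i<m. B i). h b = real (Suc (THE i. b \<in> B i))" "\<forall>y\<in>W \<union> F. h y = 0"
    using tychonoff_interpolation[OF X, of "W \<union> F" "\<Union>i<m. B i" "\<lambda>b. real (Suc (THE i. b \<in> B i))"] UB
    by blast
  have hB: "h b = real (Suc i)" if "i < m" "b \<in> B i" for i b
  proof -
    have "(THE i. b \<in> B i) = i" using that(2) B_disj by (intro the_equality) auto
    then show ?thesis using h(2) that by auto
  qed
  \<comment> \<open>The bands of half-width 1/3 around the integer levels are disjoint.
    \<open>V i\<close> and \<open>C i\<close> together cover the space, so a function vanishing on
    \<open>C i\<close> lives on \<open>V i\<close>.\<close>
  define V where "V i = {x \<in> topspace X. h x \<in> {real (Suc i) - 1 / 3 .. real (Suc i) + 1 / 3}}" for i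
  define C where "C i = {x \<in> topspace X. h x \<in> {.. real (Suc i) - 1 / 3} \<union> {real (Suc i) + 1 / 3 ..}}" for i
  have V_closed: "closedin X (V i)" and C_closed: "closedin X (C i)" for i
    unfolding V_def C_def by (intro closedin_continuous_map_preimage[OF Cp_memD(1)[OF h(1)]]; auto)+
  have V_disj: "i = j" if "x \<in> V i" "x \<in> V j" for i j x
  proof -
    have "real i < real (Suc j)" "real j < real (Suc i)" using that by (auto simp: V_def)
    then show ?thesis by linarith
  qed
  \<comment> \<open>Every measure is small on one of the \<open>m\<close> bands, so a single band
    serves infinitely many of them.\<close>
  have "\<exists>i\<in>{..<m}. infinite {k \<in> N. variation (A k) (c k) (V i) \<le> 1 / real m}"
  proof (rule pigeonhole_infinite_rel[OF N])
    have "\<exists>i<m. variation (A k) (c k) (V i) \<le> 1 / real m" for k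
      by (rule small_variation_on_disjoint_sets[OF A(1) _ m(1)], simp add: A(3), erule (1) V_disj)
    then show "\<forall>k\<in>N. \<exists>i\<in>{..<m}. variation (A k) (c k) (V i) \<le> 1 / real m"
      unfolding Bex_def lessThan_iff by blast
  qed simp
  then obtain i where i: "i < m" "infinite {k \<in> N. variation (A k) (c k) (V i) \<le> 1 / real m}"
    unfolding Bex_def lessThan_iff by blast
  \<comment> \<open>Requiring zeros also on \<open>A (n i) - B i\<close> lets the integral of
    \<open>f\<close> see only \<open>B i\<close>, where the signs give the full mass.\<close>
  have "closedin X (C i \<union> (A (n i) - B i))"
    using A by (intro closedin_Un C_closed tychonoff_finite_closed[OF X]) auto
  moreover have "B i \<inter> (C i \<union> (A (n i) - B i)) = {}" using hB[OF i(1)] by (auto simp: C_def)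
  ultimately obtain f where f: "f \<in> topspace (Cp X)" "\<forall>x. \<bar>f x\<bar> \<le> 1" "\<forall>b\<in>B i. f b = sgn (c (n i) b)"
    "\<forall>y\<in>C i \<union> (A (n i) - B i). f y = 0"
    using tychonoff_bounded_interpolation[OF X _ B(1)[of i] B(2), where C = "C i \<union> (A (n i) - B i)" and s = "\<lambda>b. sgn (c (n i) b)"]
    by (auto simp: abs_sgn_eq)
  have "evaluation (A (n i)) (c (n i)) f = (\<Sum>x\<in>B i. c (n i) x * f x)"
    unfolding evaluation_def using f(4) A(1) by (intro sum.mono_neutral_right) (auto simp: B_def)
  also have "\<dots> = (\<Sum>x\<in>B i. \<bar>c (n i) x\<bar>)" using f(3) by (intro sum.cong) (auto simp: abs_sgn)
  also have "\<dots> = variation (A (n i)) (c (n i)) (- (W \<union> G i))"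
    by (simp add: variation_def B_def Diff_eq)
  finally have ev: "1 / 4 \<le> evaluation (A (n i)) (c (n i)) f" using n(2)[of i] by simp
  have f_null: "(\<lambda>k. \<bar>evaluation (A k) (c k) f\<bar>) \<longlonglongrightarrow> 0"
    using JN f(1) unfolding JN_sequence_def tendsto_rabs_zero_iff by blast
  define N' where "N' = {k \<in> {k \<in> N. variation (A k) (c k) (V i) \<le> 1 / real m}.
      n i < k \<and> \<bar>evaluation (A k) (c k) f\<bar> < \<delta>}"
  show ?thesis
  proof (rule that[of "n i" f "W \<union> V i" N'])
    show "n i \<in> N" by (rule n)
    show "f x = 0" if "x \<in> W \<union> F" for x
    proof -
      have "x \<in> C i" using that h(3) Wsub F(2) by (auto simp: C_def)
      then show ?thesis using f(4) by blast
    qed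
    show "closedin X (W \<union> V i)" by (intro closedin_Un W V_closed)
    show "f x = 0" if "x \<notin> W \<union> V i" for x
    proof (cases "x \<in> topspace X")
      case True
      then have "x \<in> C i" using that by (auto simp: C_def V_def)
      then show ?thesis using f(4) by blast
    qed (rule Cp_memD(2)[OF f(1)])
    show "infinite N'"
      unfolding N'_def
      by (intro infinite_Collect_eventually i eventually_conj eventually_gt_at_top
          order_tendstoD(2)[OF f_null \<delta>])
    show "variation (A k) (c k) (W \<union> V i) \<le> \<beta> + \<delta>" if "k \<in> N'" for k
    proof -
      have "variation (A k) (c k) (W \<union> V i) \<le> variation (A k) (c k) W + variation (A k) (c k) (V i)"
        by (rule variation_cover[OF A(1)]) auto
      then show ?thesis using that \<beta>(2)[of k] m(2) by (auto simp: N'_def)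
    qed
  qed (use f ev in \<open>auto simp: N'_def\<close>)
qed

text \<open>The extraction step is iterated. Vanishing on the earlier \<open>W\<close> makes the
  supports disjoint, vanishing on the supports collected in \<open>F\<close> kills the entries above
  the diagonal, and shrinking \<open>N\<close> controls those below it.\<close>

lemma JN_sequence_extraction:
  assumes X: "tychonoff_space X" and JN: "JN_sequence X A c"
  obtains n f where "strict_mono (n :: nat \<Rightarrow> nat)" "\<And>k. f k \<in> topspace (Cp X)" "\<And>k x. \<bar>f k x\<bar> \<le> 1"
    "\<And>j k x. j \<noteq> k \<Longrightarrow> f j x * f k x = 0"
    "\<And>k. 1 / 4 \<le> evaluation (A (n k)) (c (n k)) (f k)"
    "\<And>j k. k < j \<Longrightarrow> evaluation (A (n k)) (c (n k)) (f j) = 0"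
    "\<And>j k. j < k \<Longrightarrow> \<bar>evaluation (A (n k)) (c (n k)) (f j)\<bar> \<le> (1 / 2) ^ j / 24"
proof -
  \<comment> \<open>The bound \<open>(1 - (1 / 2) ^ k) / 12\<close> stays below the admissible 1/12,
    and its increment from \<open>k\<close> to \<open>Suc k\<close> is exactly the tolerance
    \<open>(1 / 2) ^ k / 24\<close>.\<close>
  define P where "P = (\<lambda>(k::nat) (W, F, N, n::nat, f::'a \<Rightarrow> real).
    closedin X W \<and> finite F \<and> F \<subseteq> topspace X \<and> infinite N \<and>
    (\<forall>i\<in>N. variation (A i) (c i) W \<le> (1 - (1 / 2) ^ k) / 12))"
  define Q where "Q = (\<lambda>(k::nat) (W, F, N, n::nat, f::'a \<Rightarrow> real) (W', F', N', n', f').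
    n' \<in> N \<and> N' \<subseteq> N \<and> f' \<in> topspace (Cp X) \<and> (\<forall>x. \<bar>f' x\<bar> \<le> 1) \<and> (\<forall>x\<in>W \<union> F. f' x = 0) \<and>
    W \<subseteq> W' \<and> (\<forall>x. x \<notin> W' \<longrightarrow> f' x = 0) \<and> F' = F \<union> A n' \<and> 1 / 4 \<le> evaluation (A n') (c n') f' \<and>
    (\<forall>i\<in>N'. n' < i \<and> \<bar>evaluation (A i) (c i) f'\<bar> \<le> (1 / 2) ^ k / 24))"
  have "\<exists>s. \<forall>k. P k (s k) \<and> Q k (s k) (s (Suc k))"
  proof (rule dependent_nat_choice)
    show "\<exists>s. P 0 s"
      unfolding P_def by (rule exI[of _ "({}, {}, UNIV, 0, \<lambda>x. 0)"]) (simp add: variation_def)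
    fix s and k :: nat assume "P k s"
    moreover obtain W F N n f where s: "s = (W, F, N, n, f)" by (metis surj_pair)
    ultimately have W: "closedin X W" and F: "finite F" "F \<subseteq> topspace X" and N: "infinite N"
      and var: "\<And>i. i \<in> N \<Longrightarrow> variation (A i) (c i) W \<le> (1 - (1 / 2) ^ k) / 12"
      by (auto simp: P_def)
    have le: "(1 - (1 / 2) ^ k) / 12 \<le> (1 / 12 :: real)" and pos: "(1 / 2) ^ k / 24 > (0 :: real)" by simp_all
    obtain n' f' W' N' where *: "n' \<in> N" "f' \<in> topspace (Cp X)" "\<And>x. \<bar>f' x\<bar> \<le> 1"
      "\<And>x. x \<in> W \<union> F \<Longrightarrow> f' x = 0" "closedin X W'" "W \<subseteq> W'" "\<And>x. x \<notin> W' \<Longrightarrow> f' x = 0"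
      "1 / 4 \<le> evaluation (A n') (c n') f'" "N' \<subseteq> N" "infinite N'" "\<And>i. i \<in> N' \<Longrightarrow> n' < i"
      "\<And>i. i \<in> N' \<Longrightarrow> variation (A i) (c i) W' \<le> (1 - (1 / 2) ^ k) / 12 + (1 / 2) ^ k / 24"
      "\<And>i. i \<in> N' \<Longrightarrow> \<bar>evaluation (A i) (c i) f'\<bar> \<le> (1 / 2) ^ k / 24"
      using JN_sequence_extraction_step[OF X JN N W F le var pos] by blast
    have "(1 - (1 / 2) ^ k) / 12 + (1 / 2) ^ k / 24 = (1 - (1 / 2 :: real) ^ Suc k) / 12"
      by (simp add: field_simps)
    then have "\<And>i. i \<in> N' \<Longrightarrow> variation (A i) (c i) W' \<le> (1 - (1 / 2) ^ Suc k) / 12"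
      using *(12) by (simp only:)
    moreover have "finite (A n')" "A n' \<subseteq> topspace X" using JN by (auto simp: JN_sequence_def)
    ultimately have "P (Suc k) (W', F \<union> A n', N', n', f')"
      unfolding P_def using F *(5,10) by blast
    moreover have "Q k s (W', F \<union> A n', N', n', f')"
      unfolding Q_def s using * by simp
    ultimately show "\<exists>s'. P (Suc k) s' \<and> Q k s s'" by blast
  qed
  then obtain s where s: "\<And>k. Q k (s k) (s (Suc k))" by blast
  define W where "W k = fst (s k)" for k
  define F where "F k = fst (snd (s k))" for k
  define N where "N k = fst (snd (snd (s k)))" for k
  \<comment> \<open>The index and function chosen at step \<open>k\<close> are stored in state
    \<open>Suc k\<close>; those in state 0 are placeholders.\<close>
  define n where "n k = fst (snd (snd (snd (s (Suc k)))))" for k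
  define f where "f k = snd (snd (snd (snd (s (Suc k)))))" for k
  have q: "n k \<in> N k" "N (Suc k) \<subseteq> N k" "f k \<in> topspace (Cp X)" "\<And>x. \<bar>f k x\<bar> \<le> 1"
    "\<And>x. x \<in> W k \<union> F k \<Longrightarrow> f k x = 0" "W k \<subseteq> W (Suc k)" "\<And>x. x \<notin> W (Suc k) \<Longrightarrow> f k x = 0"
    "F (Suc k) = F k \<union> A (n k)" "1 / 4 \<le> evaluation (A (n k)) (c (n k)) (f k)"
    "\<And>i. i \<in> N (Suc k) \<Longrightarrow> n k < i \<and> \<bar>evaluation (A i) (c i) (f k)\<bar> \<le> (1 / 2) ^ k / 24" for k
    using s[of k] unfolding Q_def W_def F_def N_def n_def f_def case_prod_unfold by blast+
  have W_mono: "W i \<subseteq> W j" if "i \<le> j" for i j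
    by (rule lift_Suc_mono_le[OF _ that]) (rule q)
  have F_mono: "F i \<subseteq> F j" if "i \<le> j" for i j
    by (rule lift_Suc_mono_le[OF _ that]) (use q(8) in blast)
  have N_anti: "N j \<subseteq> N i" if "i \<le> j" for i j
    by (rule lift_Suc_antimono_le[OF _ that]) (rule q)
  have disj: "f j x * f k x = 0" if "j < k" for j k x
  proof (cases "x \<in> W (Suc j)")
    case True
    then show ?thesis using W_mono[of "Suc j" k] that q(5)[of x k] by auto
  qed (simp add: q(7))
  have later: "n k \<in> N (Suc j)" if "j < k" for j k
    using N_anti[of "Suc j" k] that q(1)[of k] by auto
  show ?thesis
  proof (rule that[of n f])
    show "strict_mono n" using later q(10) by (auto simp: strict_mono_def)
    show "f j x * f k x = 0" if "j \<noteq> k" for j k x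
      using disj[of j k x] disj[of k j x] that by (cases "j < k") auto
    show "evaluation (A (n k)) (c (n k)) (f j) = 0" if "k < j" for j k
    proof -
      have "A (n k) \<subseteq> F j" using q(8)[of k] F_mono[of "Suc k" j] that by auto
      then show ?thesis using q(5) by (force simp: evaluation_def intro!: sum.neutral)
    qed
    show "\<bar>evaluation (A (n k)) (c (n k)) (f j)\<bar> \<le> (1 / 2) ^ j / 24" if "j < k" for j k
      using q(10)[OF later[OF that]] by blast
  qed (rule q)+
qed

text \<open>Dividing by the diagonal, which is at least 1/4, costs a factor of at most 4. The
  entries below it become at most \<open>(1 / 2) ^ j / 6\<close>, with row sums of at most
  1/3.\<close>

lemma JN_sequence_imp_c0_quotient:
  assumes X: "tychonoff_space X" and JN: "JN_sequence X A c"
  shows "has_quotient_isomorphic (Cp X) c0_p"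
proof -
  obtain n f where n: "strict_mono (n :: nat \<Rightarrow> nat)"
    and f: "\<And>k. f k \<in> topspace (Cp X)" "\<And>k x. \<bar>f k x\<bar> \<le> 1" "\<And>j k x. j \<noteq> k \<Longrightarrow> f j x * f k x = 0"
    and diag: "\<And>k. 1 / 4 \<le> evaluation (A (n k)) (c (n k)) (f k)"
    and upper: "\<And>j k. k < j \<Longrightarrow> evaluation (A (n k)) (c (n k)) (f j) = 0"
    and lower: "\<And>j k. j < k \<Longrightarrow> \<bar>evaluation (A (n k)) (c (n k)) (f j)\<bar> \<le> (1 / 2) ^ j / 24"
    using JN_sequence_extraction[OF X JN] by blast
  define d where "d k = evaluation (A (n k)) (c (n k)) (f k)" for k
  define L where "L k = evaluation (A (n k)) (\<lambda>x. c (n k) x / d k)" for k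
  have d: "1 / 4 \<le> d k" "0 < d k" for k using diag[of k] by (auto simp: d_def)
  have L_eq: "L k g = evaluation (A (n k)) (c (n k)) g / d k" for k g
    by (simp add: L_def evaluation_def sum_divide_distrib)
  have L_le: "\<bar>L k g\<bar> \<le> 4 * \<bar>evaluation (A (n k)) (c (n k)) g\<bar>" for k g
  proof -
    have "\<bar>L k g\<bar> = \<bar>evaluation (A (n k)) (c (n k)) g\<bar> / d k"
      using d(2)[of k] by (simp add: L_eq abs_divide)
    also have "\<dots> \<le> \<bar>evaluation (A (n k)) (c (n k)) g\<bar> / (1 / 4)"
      using d by (intro divide_left_mono) auto
    finally show ?thesis by simp
  qed
  show ?thesis
  proof (rule triangular_system_gives_c0_quotient[OF _ _ f])
    show "continuous_functional X (L k)" for k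
      unfolding L_def using JN by (intro continuous_functional_evaluation) (auto simp: JN_sequence_def)
    show "(\<lambda>k. L k g) \<longlonglongrightarrow> 0" if g: "g \<in> topspace (Cp X)" for g
    proof (rule Lim_null_comparison[OF always_eventually])
      have "(\<lambda>i. evaluation (A i) (c i) g) \<longlonglongrightarrow> 0" using JN g by (simp add: JN_sequence_def)
      from LIMSEQ_subseq_LIMSEQ[OF this n]
      have "(\<lambda>k. evaluation (A (n k)) (c (n k)) g) \<longlonglongrightarrow> 0" by (simp add: comp_def)
      then show "(\<lambda>k. 4 * \<bar>evaluation (A (n k)) (c (n k)) g\<bar>) \<longlonglongrightarrow> 0"
        by (intro tendsto_mult_right_zero tendsto_rabs_zero)
      show "\<forall>k. norm (L k g) \<le> 4 * \<bar>evaluation (A (n k)) (c (n k)) g\<bar>" using L_le by simp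
    qed
    show "L k (f j) = 0" if "k < j" for j k using upper[OF that] by (simp add: L_eq)
    show "L k (f k) = 1" for k using d(2)[of k] by (simp add: L_eq d_def)
    show "(\<Sum>j<k. \<bar>L k (f j)\<bar>) \<le> 1 / 2" for k
    proof -
      have bound: "(2 - 2 * t) / 6 \<le> 1 / 2" if "0 \<le> t" for t :: real using that by simp
      have "\<bar>L k (f j)\<bar> \<le> (1 / 2) ^ j / 6" if "j < k" for j
        using L_le[of k "f j"] lower[OF that] by linarith
      then have "(\<Sum>j<k. \<bar>L k (f j)\<bar>) \<le> (\<Sum>j<k. (1 / 2) ^ j / 6)" by (intro sum_mono) auto
      also have "\<dots> = (\<Sum>j<k. (1 / 2 :: real) ^ j) / 6" by (simp add: sum_divide_distrib)
      also have "(\<Sum>j<k. (1 / 2 :: real) ^ j) = 2 - 2 * (1 / 2) ^ k" by (induction k) auto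
      also have "(2 - 2 * (1 / 2 :: real) ^ k) / 6 \<le> 1 / 2"
        by (rule bound) simp
      finally show ?thesis by simp
    qed
  qed
qed

theorem theorem3:
  fixes X :: "'a topology" and p :: real
  assumes "tychonoff_space X"
    and "1 \<le> p"
    and "\<exists>Q. continuous_linear_surjection (Cp X) (lp_p p) Q"
  shows "josefson_nissenzweig (Cp X) \<and> has_quotient_isomorphic (Cp X) c0_p"
proof -
  obtain Q where "continuous_linear_surjection (Cp X) (lp_p p) Q" using assms(3) by blast
  then obtain A c where "JN_sequence X A c"
    using surjection_onto_lp_gives_JN_sequence[OF assms(1,2)] by blast
  then show ?thesis
    using JN_sequence_imp_josefson_nissenzweig[OF assms(1)] JN_sequence_imp_c0_quotient[OF assms(1)]
    by blast
qed

end
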